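(* Let $\lambda=(\lambda_1,\ldots,\lambda_n)$ be a partition for which the multivariable Bessel polynomial $Y_\lambda$ (with parameters $a,\kappa$) is well-defined. For $\epsilon\in\mathbb{R}$ let $P^{BC}_\lambda$ be the $BC_n$ Jacobi polynomial with parameters $$k_1=\tfrac12\left(a-1+2e^{\epsilon}\right),\quad k_2=\tfrac14\left(a-1-2e^{\epsilon}\right),\quad k_3=\kappa.$$ Then $$\lim_{\epsilon\to\infty}e^{-\epsilon|\lambda|}P^{BC}_\lambda(z_1+\epsilon,\ldots,z_n+\epsilon)=Y_\lambda(e^{z_1},\ldots,e^{z_n}).$$
   Context: Let $n\ge 1$ and let $a,\kappa$ be real parameters. Partitions are integer sequences $\lambda=(\lambda_1\ge\cdots\ge\lambda_n\ge 0)$, $|\lambda|=\sum_i\lambda_i$; $\mu\subseteq\lambda$ means $\mu_i\le\lambda_i$ for all $i$, and $\mu\subset\lambda$ means $\mu\subseteq\lambda$, $\mu\ne\lambda$. Dominance order: $\mu\le\lambda$ iff $|\mu|=|\lambda|$ and $\mu_1+\cdots+\mu_i\le\lambda_1+\cdots+\lambda_i$ for all $i$. $m_\lambda=\sum_{\alpha\in S_n\lambda}x^\alpha$. Jack polynomials: $P_\lambda=P_\lambda(x;\kappa)$ is the unique symmetric polynomial of the form $m_\lambda+\sum_{\mu<\lambda}c_{\lambda\mu}m_\mu$ that is an eigenfunction of $\sum_i x_i\partial_{x_i}$ and of $D_2=\sum_{i}x_i^2\partial_{x_i}^2+2\kappa\sum_{i\ne j}\frac{x_i^2}{x_i-x_j}\partial_{x_i}$;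 $D_2P_\lambda=d_\lambda P_\lambda$ with $d_\lambda=\sum_{i}\lambda_i(\lambda_i-1+2\kappa(n-i))$. Bessel polynomials: let $D^B=D_2+\sum_i(ax_i+2)\partial_{x_i}$ and $e_\lambda=d_\lambda+a|\lambda|$. If $e_\mu\ne e_\lambda$ for all partitions $\mu\subset\lambda$, then $Y_\lambda$ is the unique symmetric polynomial of the form $P_\lambda+\sum_{\mu\subset\lambda}u_{\lambda\mu}P_\mu$ that is an eigenfunction of $D^B$. Standing assumption: $a,\kappa$ are such that $Y_\lambda$ is well-defined in this sense. $BC_n$ Jacobi polynomials with parameters $k_1,k_2,k_3$: let $$D^{BC}=\sum_{i=1}^n\frac{\partial^2}{\partial z_i^2}+\sum_{i=1}^n\left(k_1\coth\tfrac12z_i+2k_2\coth z_i\right)\frac{\partial}{\partial z_i}+k_3\sum_{i<j}\left(\coth\tfrac12(z_i-z_j)\left(\tfrac{\partial}{\partial z_i}-\tfrac{\partial}{\partial z_j}\right)+\coth\tfrac12(z_i+z_j)\left(\tfrac{\partial}{\partial z_i}+\tfrac{\partial}{\partial z_j}\right)\right)$$ and $t(z)=(t_1,\ldots,t_n)$ with $t_i=-\sinh^2(z_i/2)$. $P^{BC}_\lambda$ is the unique function of the form $P^{BC}_\lambda(z)=(-4)^{|\lambda|}P_\lambda(t(z))+\sum_{\mu\subset\lambda}u_{\lambda\mu}P_\mu(t(z))$ (Jack polynomials with parameter $\kappa=k_3$) that is an eigenfunction of $D^{BC}$. Its eigenvalue is $e^{BC}_\lambda=d_\lambda+(k_1+2k_2+1)|\lambda|$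 (with $\kappa=k_3$ in $d_\lambda$). *)

theory Defs
  imports "HOL-Analysis.Analysis"
begin

text \<open>
  Variables and parts are indexed from 0, so \<open>x\<^sub>i\<close>, \<open>\<lambda>\<^sub>i\<close> (\<open>1 \<le> i \<le> n\<close>) are \<open>x (i - 1)\<close>, \<open>lam (i - 1)\<close>.
  Polynomials in \<open>n\<close> variables are represented by the functions they induce on complex points
  \<open>x :: nat \<Rightarrow> complex\<close>, of which only the values \<open>x i\<close> with \<open>i < n\<close> matter.
\<close>

section \<open>Partitions\<close>

text \<open>
  Parts from index \<open>n\<close> on are fixed to be 0. Hence the pointwise order \<open>\<le>\<close> on functions,
  restricted to partitions, is containment, and \<open><\<close> is proper containment.
\<close>

definition partitions :: "nat \<Rightarrow> (nat \<Rightarrow> nat) set" where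
  "partitions n = {lam. antimono lam \<and> (\<forall>i\<ge>n. lam i = 0)}"

definition weight :: "nat \<Rightarrow> (nat \<Rightarrow> nat) \<Rightarrow> nat" where
  "weight n lam = (\<Sum>i<n. lam i)"

definition dominated :: "nat \<Rightarrow> (nat \<Rightarrow> nat) \<Rightarrow> (nat \<Rightarrow> nat) \<Rightarrow> bool" where
  "dominated n mu lam \<longleftrightarrow>
     weight n mu = weight n lam \<and> (\<forall>k\<le>n. (\<Sum>i<k. mu i) \<le> (\<Sum>i<k. lam i))"

definition monomial_sym :: "nat \<Rightarrow> (nat \<Rightarrow> nat) \<Rightarrow> (nat \<Rightarrow> complex) \<Rightarrow> complex" where
  "monomial_sym n lam x =
     (\<Sum>\<alpha> \<in> {lam \<circ> \<pi> | \<pi>. \<pi> permutes {..<n}}. \<Prod>i<n. x i ^ \<alpha> i)"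

section \<open>Differential operators and eigenfunctions\<close>

definition partial_deriv ::
  "nat \<Rightarrow> ((nat \<Rightarrow> complex) \<Rightarrow> complex) \<Rightarrow> (nat \<Rightarrow> complex) \<Rightarrow> complex" where
  "partial_deriv i f x = deriv (\<lambda>s. f (x(i := s))) (x i)"

text \<open>
  Since division by zero yields 0, an operator with singular coefficients is only
  meaningful off its singular set; the eigenvalue equation is therefore restricted to
  a set \<open>S\<close> of regular points.
\<close>

definition eigenfunction_on ::
  "(nat \<Rightarrow> complex) set \<Rightarrow>
   (((nat \<Rightarrow> complex) \<Rightarrow> complex) \<Rightarrow> (nat \<Rightarrow> complex) \<Rightarrow> complex) \<Rightarrow>
   ((nat \<Rightarrow> complex) \<Rightarrow> complex) \<Rightarrow> bool" where
  "eigenfunction_on S D f \<longleftrightarrow>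
     (\<exists>x\<in>S. f x \<noteq> 0) \<and> (\<exists>c. \<forall>x\<in>S. D f x = c * f x)"

definition euler_op ::
  "nat \<Rightarrow> ((nat \<Rightarrow> complex) \<Rightarrow> complex) \<Rightarrow> (nat \<Rightarrow> complex) \<Rightarrow> complex" where
  "euler_op n f x = (\<Sum>i<n. x i * partial_deriv i f x)"

definition D2 ::
  "nat \<Rightarrow> real \<Rightarrow> ((nat \<Rightarrow> complex) \<Rightarrow> complex) \<Rightarrow> (nat \<Rightarrow> complex) \<Rightarrow> complex" where
  "D2 n \<kappa> f x =
     (\<Sum>i<n. (x i)\<^sup>2 * partial_deriv i (partial_deriv i f) x) +
     2 * of_real \<kappa> * (\<Sum>i<n. \<Sum>j\<in>{..<n} - {i}. (x i)\<^sup>2 / (x i - x j) * partial_deriv i f x)"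

definition DB ::
  "nat \<Rightarrow> real \<Rightarrow> real \<Rightarrow> ((nat \<Rightarrow> complex) \<Rightarrow> complex) \<Rightarrow> (nat \<Rightarrow> complex) \<Rightarrow> complex" where
  "DB n a \<kappa> f x = D2 n \<kappa> f x + (\<Sum>i<n. (of_real a * x i + 2) * partial_deriv i f x)"

definition regular_points :: "nat \<Rightarrow> (nat \<Rightarrow> complex) set" where
  "regular_points n = {x. \<forall>i<n. \<forall>j<n. i \<noteq> j \<longrightarrow> x i \<noteq> x j}"

definition coth :: "complex \<Rightarrow> complex" where
  "coth w = cosh w / sinh w"

definition DBC ::
  "nat \<Rightarrow> real \<Rightarrow> real \<Rightarrow> real \<Rightarrow>
   ((nat \<Rightarrow> complex) \<Rightarrow> complex) \<Rightarrow> (nat \<Rightarrow> complex) \<Rightarrow> complex" where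
  "DBC n k1 k2 k3 f z =
     (\<Sum>i<n. partial_deriv i (partial_deriv i f) z) +
     (\<Sum>i<n. (of_real k1 * coth (z i / 2) + 2 * of_real k2 * coth (z i)) * partial_deriv i f z) +
     of_real k3 * (\<Sum>i<n. \<Sum>j\<in>{i<..<n}.
       coth ((z i - z j) / 2) * (partial_deriv i f z - partial_deriv j f z) +
       coth ((z i + z j) / 2) * (partial_deriv i f z + partial_deriv j f z))"

definition regular_points_BC :: "nat \<Rightarrow> (nat \<Rightarrow> complex) set" where
  "regular_points_BC n =
     {z. (\<forall>i<n. sinh (z i / 2) \<noteq> 0 \<and> sinh (z i) \<noteq> 0) \<and>
         (\<forall>i<n. \<forall>j<n. i \<noteq> j \<longrightarrow>
            sinh ((z i - z j) / 2) \<noteq> 0 \<and> sinh ((z i + z j) / 2) \<noteq> 0)}"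

section \<open>Jack polynomials\<close>

definition is_jack ::
  "nat \<Rightarrow> real \<Rightarrow> (nat \<Rightarrow> nat) \<Rightarrow> ((nat \<Rightarrow> complex) \<Rightarrow> complex) \<Rightarrow> bool" where
  "is_jack n \<kappa> lam p \<longleftrightarrow>
     (\<exists>c. p = (\<lambda>x. monomial_sym n lam x +
        (\<Sum>mu \<in> {mu \<in> partitions n. dominated n mu lam \<and> mu \<noteq> lam}. c mu * monomial_sym n mu x))) \<and>
     eigenfunction_on UNIV (euler_op n) p \<and>
     eigenfunction_on (regular_points n) (D2 n \<kappa>) p"

definition jack :: "nat \<Rightarrow> real \<Rightarrow> (nat \<Rightarrow> nat) \<Rightarrow> (nat \<Rightarrow> complex) \<Rightarrow> complex" where
  "jack n \<kappa> lam = (THE p. is_jack n \<kappa> lam p)"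

section \<open>Multivariable Bessel polynomials\<close>

text \<open>With 0-based indices, the factor \<open>n - i\<close> of the 1-based formula is \<open>n - 1 - i\<close>.\<close>

definition d_eigenvalue :: "nat \<Rightarrow> real \<Rightarrow> (nat \<Rightarrow> nat) \<Rightarrow> real" where
  "d_eigenvalue n \<kappa> lam =
     (\<Sum>i<n. real (lam i) * (real (lam i) - 1 + 2 * \<kappa> * (real n - 1 - real i)))"

definition e_eigenvalue :: "nat \<Rightarrow> real \<Rightarrow> real \<Rightarrow> (nat \<Rightarrow> nat) \<Rightarrow> real" where
  "e_eigenvalue n a \<kappa> lam = d_eigenvalue n \<kappa> lam + a * real (weight n lam)"

text \<open>
  The first conjunct excludes the exceptional (negative) \<open>\<kappa>\<close> for which one of the Jack
  polynomials entering the expansion is not defined.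
\<close>

definition bessel_well_defined :: "nat \<Rightarrow> real \<Rightarrow> real \<Rightarrow> (nat \<Rightarrow> nat) \<Rightarrow> bool" where
  "bessel_well_defined n a \<kappa> lam \<longleftrightarrow>
     (\<forall>mu \<in> partitions n. mu \<le> lam \<longrightarrow> (\<exists>!p. is_jack n \<kappa> mu p)) \<and>
     (\<forall>mu \<in> partitions n. mu < lam \<longrightarrow> e_eigenvalue n a \<kappa> mu \<noteq> e_eigenvalue n a \<kappa> lam)"

definition is_bessel ::
  "nat \<Rightarrow> real \<Rightarrow> real \<Rightarrow> (nat \<Rightarrow> nat) \<Rightarrow> ((nat \<Rightarrow> complex) \<Rightarrow> complex) \<Rightarrow> bool" where
  "is_bessel n a \<kappa> lam Y \<longleftrightarrow>
     (\<exists>u. Y = (\<lambda>x. jack n \<kappa> lam x +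
        (\<Sum>mu \<in> {mu \<in> partitions n. mu < lam}. u mu * jack n \<kappa> mu x))) \<and>
     eigenfunction_on (regular_points n) (DB n a \<kappa>) Y"

section \<open>Jacobi polynomials of type BC\<close>

definition t_coord :: "(nat \<Rightarrow> complex) \<Rightarrow> nat \<Rightarrow> complex" where
  "t_coord z = (\<lambda>i. - (sinh (z i / 2))\<^sup>2)"

definition is_jacobi_BC ::
  "nat \<Rightarrow> real \<Rightarrow> real \<Rightarrow> real \<Rightarrow> (nat \<Rightarrow> nat) \<Rightarrow>
   ((nat \<Rightarrow> complex) \<Rightarrow> complex) \<Rightarrow> bool" where
  "is_jacobi_BC n k1 k2 k3 lam P \<longleftrightarrow>
     (\<exists>u. P = (\<lambda>z. (-4) ^ weight n lam * jack n k3 lam (t_coord z) +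
        (\<Sum>mu \<in> {mu \<in> partitions n. mu < lam}. u mu * jack n k3 mu (t_coord z)))) \<and>
     eigenfunction_on (regular_points_BC n) (DBC n k1 k2 k3) P"

end

theory Submission
  imports Defs
begin

text \<open>
  In the coordinates \<open>x\<^sub>i = 4 \<delta> sinh\<^sup>2 (z\<^sub>i / 2)\<close> with \<open>\<delta> = e\<^sup>-\<^sup>\<epsilon>\<close>, the rescaled Jacobi polynomial is a
  combination \<open>P\<^sub>\<lambda> + \<Sum> v\<^sub>\<mu> P\<^sub>\<mu>\<close> of Jack polynomials, and \<open>D\<^sup>B\<^sup>C\<close> becomes \<open>D\<^sub>2 + a \<Sum> x\<^sub>i \<partial>\<^sub>i + M\<close>, where \<open>M\<close>
  lowers the degree by 1, is affine in \<open>\<delta>\<close>, and equals \<open>2 \<Sum> \<partial>\<^sub>i\<close> at \<open>\<delta> = 0\<close>, so that \<open>D\<^sup>B\<close> is the limit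
  operator. Comparing homogeneous components of the eigenvalue equation gives the recursion
  \<open>\<Sum> (e\<^sub>\<lambda> - e\<^sub>\<mu>) v\<^sub>\<mu> P\<^sub>\<mu> = \<Sum> v\<^sub>\<nu> M P\<^sub>\<nu>\<close>, with \<open>\<mu>\<close> running over degree \<open>k\<close> and \<open>\<nu>\<close> over degree \<open>k + 1\<close>.
  As the Jack polynomials are linearly independent and \<open>e\<^sub>\<mu> \<noteq> e\<^sub>\<lambda>\<close>, descending induction on the degree
  shows that the \<open>v\<^sub>\<mu>\<close> converge to the Bessel coefficients. That \<open>M\<close> maps \<open>P\<^sub>\<nu>\<close> into the span of the
  \<open>P\<^sub>\<mu>\<close> with \<open>\<mu> \<subset> \<nu>\<close> is never needed, since both eigenfunctions are given in expanded form.
\<close>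

section \<open>Partial derivatives of functions polynomial in one variable\<close>

text \<open>Polynomiality in a single variable supplies the differentiability: it survives linear
  combinations and \<open>partial_deriv i\<close>, so second derivatives exist as well.\<close>

definition poly_in :: "nat \<Rightarrow> ((nat \<Rightarrow> complex) \<Rightarrow> complex) \<Rightarrow> bool" where
  "poly_in i f \<longleftrightarrow> (\<forall>x. \<exists>p. \<forall>s. f (x(i := s)) = poly p s)"

lemma poly_in_const: "poly_in i (\<lambda>_. c)"
  unfolding poly_in_def by (intro allI exI[of _ "[:c:]"]) simp

lemma poly_in_add: "poly_in i f \<Longrightarrow> poly_in i g \<Longrightarrow> poly_in i (\<lambda>x. f x + g x)"
  unfolding poly_in_def by (metis poly_add)

lemma poly_in_scale: "poly_in i f \<Longrightarrow> poly_in i (\<lambda>x. c * f x)"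
  unfolding poly_in_def by (metis poly_smult)

lemma poly_in_sum:
  assumes "\<And>m. m \<in> I \<Longrightarrow> poly_in i (f m)"
  shows "poly_in i (\<lambda>x. \<Sum>m\<in>I. c m * f m x)"
  using assms
  by (induction I rule: infinite_finite_induct)
    (simp_all add: poly_in_const poly_in_add poly_in_scale)

lemma has_partial_deriv:
  assumes "poly_in i f"
  shows "((\<lambda>s. f (x(i := s))) has_field_derivative partial_deriv i f (x(i := t))) (at t)"
proof -
  obtain p where p: "\<And>s. f (x(i := s)) = poly p s"
    using assms unfolding poly_in_def by blast
  show ?thesis
    using poly_DERIV[of p t] by (simp add: partial_deriv_def p DERIV_imp_deriv[OF poly_DERIV])
qed

lemma partial_derivI:
  assumes "((\<lambda>s. f (x(i := s))) has_field_derivative d) (at (x i))"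
  shows "partial_deriv i f x = d"
  using assms unfolding partial_deriv_def by (rule DERIV_imp_deriv)

lemma has_partial_deriv':
  assumes "poly_in i f"
  shows "((\<lambda>s. f (x(i := s))) has_field_derivative partial_deriv i f x) (at (x i))"
  using has_partial_deriv[OF assms, of x "x i"] by simp

lemma poly_in_partial_deriv:
  assumes "poly_in i f"
  shows "poly_in i (partial_deriv i f)"
  unfolding poly_in_def
proof
  fix x
  obtain p where p: "\<And>s. f (x(i := s)) = poly p s"
    using assms unfolding poly_in_def by blast
  have "partial_deriv i f (x(i := s)) = poly (pderiv p) s" for s
    by (simp add: partial_deriv_def p DERIV_imp_deriv[OF poly_DERIV])
  thus "\<exists>p. \<forall>s. partial_deriv i f (x(i := s)) = poly p s" by blast
qed

lemma partial_deriv_add: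
  assumes "poly_in i f" "poly_in i g"
  shows "partial_deriv i (\<lambda>x. f x + g x) = (\<lambda>x. partial_deriv i f x + partial_deriv i g x)"
  by (intro ext partial_derivI DERIV_add has_partial_deriv' assms)

lemma partial_deriv_scale:
  assumes "poly_in i f"
  shows "partial_deriv i (\<lambda>x. c * f x) = (\<lambda>x. c * partial_deriv i f x)"
  by (intro ext partial_derivI DERIV_cmult has_partial_deriv' assms)

text \<open>Chain rule for the substitution t / s. The factor \<open>r\<close> stands abstractly in
  place of \<open>s ^ k\<close>, so that the lemma applies again to its own conclusion and yields
  \<open>r / s / s\<close> for the second derivative.\<close>

lemma partial_deriv_homogeneous:
  assumes f: "poly_in i f" and s: "s \<noteq> 0"
    and hom: "\<And>y. f (\<lambda>j. s * y j) = r * f y"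
  shows "partial_deriv i f (\<lambda>j. s * x j) = r / s * partial_deriv i f x"
proof (rule partial_derivI)
  have eq: "(\<lambda>j. s * x j)(i := t) = (\<lambda>j. s * (x(i := t / s)) j)" for t
    using s by (auto simp: fun_eq_iff)
  have "((\<lambda>t. f (x(i := t))) has_field_derivative partial_deriv i f x) (at (s * x i / s))"
    using has_partial_deriv'[OF f, of x] s by simp
  hence "((\<lambda>t. f (x(i := t / s))) has_field_derivative partial_deriv i f x * (1 / s)) (at (s * x i))"
    by (rule DERIV_chain2) (auto intro!: derivative_eq_intros simp: s)
  hence "((\<lambda>t. r * f (x(i := t / s))) has_field_derivative r * (partial_deriv i f x * (1 / s)))
      (at (s * x i))"
    by (rule DERIV_cmult)
  thus "((\<lambda>t. f ((\<lambda>j. s * x j)(i := t))) has_field_derivative r / s * partial_deriv i f x)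
      (at (s * x i))"
    by (simp add: eq hom del: fun_upd_apply)
qed

section \<open>Second-order operators without mixed derivatives\<close>

definition diff_op ::
  "nat \<Rightarrow> (nat \<Rightarrow> (nat \<Rightarrow> complex) \<Rightarrow> complex) \<Rightarrow> (nat \<Rightarrow> (nat \<Rightarrow> complex) \<Rightarrow> complex) \<Rightarrow>
   ((nat \<Rightarrow> complex) \<Rightarrow> complex) \<Rightarrow> (nat \<Rightarrow> complex) \<Rightarrow> complex" where
  "diff_op n A b f x = (\<Sum>i<n. A i x * partial_deriv i (partial_deriv i f) x + b i x * partial_deriv i f x)"

lemma diff_op_add_scale:
  assumes "\<And>i. poly_in i f" "\<And>i. poly_in i g"
  shows "diff_op n A b (\<lambda>x. f x + c * g x) x = diff_op n A b f x + c * diff_op n A b g x"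
  by (simp add: diff_op_def partial_deriv_add partial_deriv_scale poly_in_scale
      poly_in_partial_deriv assms sum.distrib sum_distrib_left algebra_simps)

lemma diff_op_zero: "diff_op n A b (\<lambda>_. 0) x = 0"
proof -
  have "partial_deriv i (\<lambda>_. 0) = (\<lambda>_. 0)" for i
    by (intro ext partial_derivI) simp
  thus ?thesis by (simp add: diff_op_def)
qed

lemma diff_op_sum:
  assumes "finite I" "\<And>m i. m \<in> I \<Longrightarrow> poly_in i (f m)"
  shows "diff_op n A b (\<lambda>x. \<Sum>m\<in>I. c m * f m x) x = (\<Sum>m\<in>I. c m * diff_op n A b (f m) x)"
  using assms
proof (induction I rule: finite_induct)
  case empty
  show ?case by (simp add: diff_op_zero)
next
  case (insert k I)
  have "diff_op n A b (\<lambda>x. (\<Sum>m\<in>I. c m * f m x) + c k * f k x) x =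
      diff_op n A b (\<lambda>x. \<Sum>m\<in>I. c m * f m x) x + c k * diff_op n A b (f k) x"
    by (rule diff_op_add_scale) (use insert.prems in \<open>auto intro: poly_in_sum\<close>)
  thus ?case using insert by (simp add: add.commute)
qed

definition D2_coeff1 :: "nat \<Rightarrow> real \<Rightarrow> nat \<Rightarrow> (nat \<Rightarrow> complex) \<Rightarrow> complex" where
  "D2_coeff1 n \<kappa> i x = 2 * of_real \<kappa> * (\<Sum>j\<in>{..<n} - {i}. (x i)\<^sup>2 / (x i - x j))"

lemma D2_diff_op: "D2 n \<kappa> = diff_op n (\<lambda>i x. (x i)\<^sup>2) (D2_coeff1 n \<kappa>)"
  by (intro ext) (simp add: D2_def diff_op_def D2_coeff1_def sum.distrib sum_distrib_left
      sum_distrib_right mult.assoc)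

lemma euler_op_diff_op: "euler_op n = diff_op n (\<lambda>_ _. 0) (\<lambda>i x. x i)"
  by (intro ext) (simp add: euler_op_def diff_op_def)

section \<open>Spans of monomials\<close>

definition mono_fun :: "nat \<Rightarrow> (nat \<Rightarrow> nat) \<Rightarrow> (nat \<Rightarrow> complex) \<Rightarrow> complex" where
  "mono_fun n \<alpha> x = (\<Prod>i<n. x i ^ \<alpha> i)"

text \<open>The linear span is built one term at a time, so that facts stable under adding a
  multiple of a monomial follow by rule induction. With \<open>Q\<close> the exponents of weight k,
  its members are the homogeneous polynomials of degree k.\<close>

inductive_set mspan :: "nat \<Rightarrow> (nat \<Rightarrow> nat) set \<Rightarrow> ((nat \<Rightarrow> complex) \<Rightarrow> complex) set"
  for n Q where
  zero: "(\<lambda>_. 0) \<in> mspan n Q"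
| step: "f \<in> mspan n Q \<Longrightarrow> \<alpha> \<in> Q \<Longrightarrow> (\<lambda>x. f x + c * mono_fun n \<alpha> x) \<in> mspan n Q"

lemma mspan_add:
  assumes "f \<in> mspan n Q" "g \<in> mspan n Q"
  shows "(\<lambda>x. f x + g x) \<in> mspan n Q"
  using assms(2)
proof induction
  case zero
  show ?case using assms(1) by simp
next
  case (step g \<alpha> c)
  from mspan.step[OF step.IH step.hyps(2), of c] show ?case by (simp add: add.assoc)
qed

lemma mspan_scale:
  assumes "f \<in> mspan n Q"
  shows "(\<lambda>x. b * f x) \<in> mspan n Q"
  using assms
proof induction
  case zero
  show ?case by (simp add: mspan.zero)
next
  case (step g \<alpha> c)
  from mspan.step[OF step.IH step.hyps(2), of "b * c"] show ?case
    by (simp add: algebra_simps)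
qed

lemma mspan_sum:
  assumes "\<And>m. m \<in> I \<Longrightarrow> f m \<in> mspan n Q"
  shows "(\<lambda>x. \<Sum>m\<in>I. f m x) \<in> mspan n Q"
  using assms
  by (induction I rule: infinite_finite_induct) (auto intro: mspan.zero mspan_add)

lemma mspan_mono_fun: "\<alpha> \<in> Q \<Longrightarrow> mono_fun n \<alpha> \<in> mspan n Q"
  using mspan.step[OF mspan.zero, where c = 1] by simp

lemma mspan_mono:
  assumes "Q \<subseteq> Q'" "f \<in> mspan n Q"
  shows "f \<in> mspan n Q'"
  using assms(2) by induction (use assms(1) in \<open>auto intro: mspan.intros\<close>)

lemma poly_in_mono_fun: "poly_in i (mono_fun n \<alpha>)"
  unfolding poly_in_def
proof
  fix x :: "nat \<Rightarrow> complex"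
  define p where "p = (\<Prod>j<n. (if j = i then [:0, 1:] else [:x j:]) ^ \<alpha> j)"
  have "mono_fun n \<alpha> (x(i := s)) = poly p s" for s
    unfolding mono_fun_def p_def poly_prod by (intro prod.cong) auto
  thus "\<exists>p. \<forall>s. mono_fun n \<alpha> (x(i := s)) = poly p s" by blast
qed

lemma mspan_poly_in: "f \<in> mspan n Q \<Longrightarrow> poly_in i f"
  by (induction rule: mspan.induct)
    (simp_all add: poly_in_const poly_in_add poly_in_scale poly_in_mono_fun)

lemma mspan_homogeneous:
  assumes "f \<in> mspan n {\<alpha>. weight n \<alpha> = k}"
  shows "f (\<lambda>j. s * x j) = s ^ k * f x"
  using assms
proof induction
  case (step f \<alpha> c)
  have "mono_fun n \<alpha> (\<lambda>j. s * x j) = s ^ k * mono_fun n \<alpha> x"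
    using step.hyps(2)
    by (auto simp: mono_fun_def power_mult_distrib prod.distrib weight_def power_sum)
  thus ?case using step.IH by (simp add: algebra_simps)
qed simp

lemma mspan_tendsto:
  assumes "f \<in> mspan n Q" "\<And>i. i < n \<Longrightarrow> ((\<lambda>e. X e i) \<longlongrightarrow> x i) F"
  shows "((\<lambda>e. f (X e)) \<longlongrightarrow> f x) F"
  using assms(1)
  by induction (auto intro!: tendsto_intros assms(2) simp: mono_fun_def)

section \<open>Monomials under the Euler operator and \<open>D2\<close>\<close>

lemma partial_deriv_mono_fun:
  assumes "i < n"
  shows "partial_deriv i (mono_fun n \<alpha>) x =
    (\<Prod>j\<in>{..<n} - {i}. x j ^ \<alpha> j) * (of_nat (\<alpha> i) * x i ^ (\<alpha> i - 1))"
    and "partial_deriv i (partial_deriv i (mono_fun n \<alpha>)) x =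
    (\<Prod>j\<in>{..<n} - {i}. x j ^ \<alpha> j) *
      (of_nat (\<alpha> i) * (of_nat (\<alpha> i - 1) * x i ^ (\<alpha> i - 1 - 1)))"
proof -
  have m: "mono_fun n \<alpha> (x(i := s)) = (\<Prod>j\<in>{..<n} - {i}. x j ^ \<alpha> j) * s ^ \<alpha> i" for x s
    using assms by (simp add: mono_fun_def prod.remove[of "{..<n}" i] mult.commute)
  show *: "partial_deriv i (mono_fun n \<alpha>) x =
    (\<Prod>j\<in>{..<n} - {i}. x j ^ \<alpha> j) * (of_nat (\<alpha> i) * x i ^ (\<alpha> i - 1))" for x
    unfolding partial_deriv_def m
    by (rule DERIV_imp_deriv) (auto intro!: derivative_eq_intros)
  show "partial_deriv i (partial_deriv i (mono_fun n \<alpha>)) x =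
    (\<Prod>j\<in>{..<n} - {i}. x j ^ \<alpha> j) *
      (of_nat (\<alpha> i) * (of_nat (\<alpha> i - 1) * x i ^ (\<alpha> i - 1 - 1)))"
    unfolding partial_deriv_def[of i "partial_deriv i (mono_fun n \<alpha>)"] *
    by (rule DERIV_imp_deriv) (auto intro!: derivative_eq_intros)
qed

lemma mult_partial_deriv_mono_fun:
  assumes "i < n"
  shows "x i * partial_deriv i (mono_fun n \<alpha>) x = of_nat (\<alpha> i) * mono_fun n \<alpha> x"
    and "(x i)\<^sup>2 * partial_deriv i (partial_deriv i (mono_fun n \<alpha>)) x =
      of_nat (\<alpha> i) * of_nat (\<alpha> i - 1) * mono_fun n \<alpha> x"
proof -
  have m: "mono_fun n \<alpha> x = (\<Prod>j\<in>{..<n} - {i}. x j ^ \<alpha> j) * x i ^ \<alpha> i"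
    using assms by (simp add: mono_fun_def prod.remove[of "{..<n}" i] mult.commute)
  show "x i * partial_deriv i (mono_fun n \<alpha>) x = of_nat (\<alpha> i) * mono_fun n \<alpha> x"
    unfolding partial_deriv_mono_fun[OF assms] m by (cases "\<alpha> i") auto
  show "(x i)\<^sup>2 * partial_deriv i (partial_deriv i (mono_fun n \<alpha>)) x =
      of_nat (\<alpha> i) * of_nat (\<alpha> i - 1) * mono_fun n \<alpha> x"
  proof (cases "\<alpha> i \<ge> 2")
    case True
    then obtain k where "\<alpha> i = Suc (Suc k)" by (metis add_2_eq_Suc le_Suc_ex)
    thus ?thesis unfolding partial_deriv_mono_fun[OF assms] m by (simp add: power2_eq_square)
  next
    \<comment> \<open>Natural subtraction truncates for the exponents 0 and 1, but there the
      coefficient vanishes.\<close>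
    case False
    hence "of_nat (\<alpha> i) * (of_nat (\<alpha> i - 1) :: complex) = 0" by auto
    thus ?thesis unfolding partial_deriv_mono_fun[OF assms] m by auto
  qed
qed

text \<open>A single monomial is multiplied by a rational function, whose behaviour along curves
  gives the eigenvalues later. Where coordinates collide, division by 0 gives 0 on both
  sides.\<close>

lemma D2_mono_fun:
  "D2 n \<kappa> (mono_fun n \<alpha>) x =
    ((\<Sum>i<n. of_nat (\<alpha> i) * of_nat (\<alpha> i - 1)) +
     2 * of_real \<kappa> * (\<Sum>i<n. \<Sum>j\<in>{..<n} - {i}. x i / (x i - x j) * of_nat (\<alpha> i)))
    * mono_fun n \<alpha> x"
proof -
  have "(x i)\<^sup>2 / (x i - x j) * partial_deriv i (mono_fun n \<alpha>) x =
      x i / (x i - x j) * of_nat (\<alpha> i) * mono_fun n \<alpha> x" if "i < n" for i j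
  proof -
    have "(x i)\<^sup>2 / (x i - x j) * partial_deriv i (mono_fun n \<alpha>) x =
        x i / (x i - x j) * (x i * partial_deriv i (mono_fun n \<alpha>) x)"
      by (simp add: power2_eq_square)
    thus ?thesis unfolding mult_partial_deriv_mono_fun[OF that] by (simp only: mult.assoc)
  qed
  hence "(\<Sum>i<n. \<Sum>j\<in>{..<n} - {i}. (x i)\<^sup>2 / (x i - x j) * partial_deriv i (mono_fun n \<alpha>) x) =
      (\<Sum>i<n. \<Sum>j\<in>{..<n} - {i}. x i / (x i - x j) * of_nat (\<alpha> i)) * mono_fun n \<alpha> x"
    unfolding sum_distrib_right by (intro sum.cong refl) auto
  thus ?thesis
    by (simp only: D2_def distrib_right mult.assoc)
      (simp add: mult_partial_deriv_mono_fun sum_distrib_right mult.assoc)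
qed

lemma euler_op_mspan:
  assumes "f \<in> mspan n {\<alpha>. weight n \<alpha> = k}"
  shows "euler_op n f x = of_nat k * f x"
  using assms
proof induction
  case zero
  show ?case by (simp add: euler_op_diff_op diff_op_zero)
next
  case (step f \<alpha> c)
  have "euler_op n (mono_fun n \<alpha>) x = of_nat k * mono_fun n \<alpha> x"
    using step.hyps(2)
    by (auto simp: euler_op_def mult_partial_deriv_mono_fun weight_def simp flip: sum_distrib_right)
  thus ?case
    using step.IH mspan_poly_in[OF step.hyps(1)]
    by (simp add: euler_op_diff_op diff_op_add_scale poly_in_mono_fun algebra_simps)
qed

section \<open>Leading monomials of Jack polynomials\<close>

text \<open>The exponents that stay strictly below \<open>\<mu>\<close> for every strictly decreasing weighting of the
  variables; dominance is only used through this consequence.\<close>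

definition lower_exps :: "nat \<Rightarrow> (nat \<Rightarrow> nat) \<Rightarrow> (nat \<Rightarrow> nat) set" where
  "lower_exps n \<mu> = {\<alpha>. weight n \<alpha> = weight n \<mu> \<and>
     (\<forall>y :: nat \<Rightarrow> nat. (\<forall>i j. i < j \<longrightarrow> j < n \<longrightarrow> y j < y i) \<longrightarrow>
        (\<Sum>i<n. y i * \<alpha> i) < (\<Sum>i<n. y i * \<mu> i))}"

text \<open>Abel summation, over \<open>int\<close> because the increments may be negative.\<close>

lemma summation_by_parts_lessThan:
  fixes d y :: "nat \<Rightarrow> int"
  shows "(\<Sum>i<Suc m. y i * d i) =
    y m * (\<Sum>i<Suc m. d i) + (\<Sum>k<m. (y k - y (Suc k)) * (\<Sum>i<Suc k. d i))"
  by (induction m) (simp_all add: algebra_simps)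

text \<open>By Abel summation the difference of the two weighted sums combines the partial sums of
  \<mu> - \<alpha> with the positive coefficients \<open>y k - y (Suc k)\<close>. These partial sums
  are nonnegative with total 0, and a positive one among them makes the inequality strict.\<close>

lemma lower_expsI:
  assumes w: "weight n \<alpha> = weight n \<mu>"
    and le: "\<And>k. k \<le> n \<Longrightarrow> (\<Sum>i<k. \<alpha> i) \<le> (\<Sum>i<k. \<mu> i)"
    and ne: "i0 < n" "\<alpha> i0 \<noteq> \<mu> i0"
  shows "\<alpha> \<in> lower_exps n \<mu>"
proof -
  have "(\<Sum>i<n. y i * \<alpha> i) < (\<Sum>i<n. y i * \<mu> i)"
    if y: "\<And>i j. i < j \<Longrightarrow> j < n \<Longrightarrow> y j < y i" for y :: "nat \<Rightarrow> nat"
  proof -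
    obtain m where m: "n = Suc m" using ne(1) by (cases n) auto
    define d where "d i = int (\<mu> i) - int (\<alpha> i)" for i
    have D: "(\<Sum>i<k. d i) = int (\<Sum>i<k. \<mu> i) - int (\<Sum>i<k. \<alpha> i)" for k
      by (simp add: d_def sum_subtractf)
    have D_nonneg: "(\<Sum>i<k. d i) \<ge> 0" if "k \<le> n" for k
      using le[OF that] unfolding D by linarith
    have D_n: "(\<Sum>i<n. d i) = 0" using w unfolding D weight_def by simp
    \<comment> \<open>If every partial sum vanished, so would the increment at
      \<open>i0\<close>.\<close>
    have "\<exists>k\<le>n. (\<Sum>i<k. d i) > 0"
    proof (rule ccontr)
      assume "\<not> (\<exists>k\<le>n. (\<Sum>i<k. d i) > 0)"
      hence "(\<Sum>i<k. d i) = 0" if "k \<le> n" for k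
        using D_nonneg[OF that] that by force
      from this[of i0] this[of "Suc i0"] have "d i0 = 0" using ne(1) by simp
      thus False using ne(2) by (simp add: d_def)
    qed
    then obtain k where k: "k \<le> n" "(\<Sum>i<k. d i) > 0" by blast
    \<comment> \<open>The partial sums of lengths 0 and n are 0, so the positive one is a term of
      the Abel sum.\<close>
    have "k \<noteq> 0" "k \<noteq> n" using k(2) D_n by (auto intro!: Nat.gr0I)
    then obtain l where l: "k = Suc l" "l < m" using k(1) m by (cases k) auto
    have "(\<Sum>k<m. (int (y k) - int (y (Suc k))) * (\<Sum>i<Suc k. d i)) > 0"
    proof (rule sum_pos2[OF _ _ _ ])
      show "l \<in> {..<m}" using l by simp
      show "0 < (int (y l) - int (y (Suc l))) * (\<Sum>i<Suc l. d i)"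
        using y[of l "Suc l"] l k(2) m by (intro mult_pos_pos) auto
      show "0 \<le> (int (y i) - int (y (Suc i))) * (\<Sum>i<Suc i. d i)" if "i \<in> {..<m}" for i
        using y[of i "Suc i"] that D_nonneg[of "Suc i"] m by (intro mult_nonneg_nonneg) auto
    qed simp
    hence "(\<Sum>i<n. int (y i) * d i) > 0"
      using summation_by_parts_lessThan[of "\<lambda>i. int (y i)" d m] D_n unfolding m by simp
    hence "int (\<Sum>i<n. y i * \<alpha> i) < int (\<Sum>i<n. y i * \<mu> i)"
      by (simp add: d_def right_diff_distrib sum_subtractf)
    thus ?thesis by linarith
  qed
  thus ?thesis using w by (auto simp: lower_exps_def)
qed

text \<open>The induction adds a new maximum \<open>b\<close> to \<open>A\<close>: all of
  \<open>A\<close> lies below \<open>b\<close>, hence \<open>card A \<le> b\<close> and the new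
  value \<open>\<nu> b\<close> is at most \<open>\<nu> (card A)\<close>.\<close>

lemma sum_antimono_le_initial:
  fixes \<nu> :: "nat \<Rightarrow> nat"
  assumes "antimono \<nu>" "finite S"
  shows "sum \<nu> S \<le> sum \<nu> {..<card S}"
  using assms(2)
proof (induction S rule: finite_linorder_max_induct)
  case (insert b A)
  have "A \<subseteq> {..<b}" using insert.hyps by auto
  from card_mono[OF _ this] have "\<nu> b \<le> \<nu> (card A)"
    by (intro antimonoD[OF assms(1)]) simp
  thus ?case using insert by (subst sum.insert) auto
qed simp

text \<open>Initial sums of a rearrangement of \<nu> are at most those of \<nu>, which dominance
  bounds by those of \<mu>.\<close>

lemma monomial_orbit_lower_exps:
  assumes \<nu>: "\<nu> \<in> partitions n" and \<mu>: "\<mu> \<in> partitions n" and dom: "dominated n \<nu> \<mu>"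
    and \<pi>: "\<pi> permutes {..<n}" and ne: "\<nu> \<circ> \<pi> \<noteq> \<mu>"
  shows "\<nu> \<circ> \<pi> \<in> lower_exps n \<mu>"
proof -
  have out: "(\<nu> \<circ> \<pi>) i = \<mu> i" if "i \<ge> n" for i
    using that \<nu> \<mu> permutes_not_in[OF \<pi>, of i] by (simp add: partitions_def)
  obtain i where i: "(\<nu> \<circ> \<pi>) i \<noteq> \<mu> i" using ne by blast
  show ?thesis
  proof (rule lower_expsI)
    show "weight n (\<nu> \<circ> \<pi>) = weight n \<mu>"
      using dom sum.permute[OF \<pi>, of \<nu>] by (simp add: weight_def dominated_def)
    show "i < n" "(\<nu> \<circ> \<pi>) i \<noteq> \<mu> i" using i out[of i] by (auto simp: not_less[symmetric])
    fix k assume k: "k \<le> n"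
    have inj: "inj_on \<pi> {..<k}" using permutes_inj[OF \<pi>] by (rule inj_on_subset) simp
    have "(\<Sum>i<k. (\<nu> \<circ> \<pi>) i) = sum \<nu> (\<pi> ` {..<k})"
      by (simp add: sum.reindex[OF inj])
    also have "\<dots> \<le> (\<Sum>i<k. \<nu> i)"
      using sum_antimono_le_initial[of \<nu> "\<pi> ` {..<k}"] \<nu> card_image[OF inj]
      by (simp add: partitions_def)
    also have "\<dots> \<le> (\<Sum>i<k. \<mu> i)" using dom k by (simp add: dominated_def)
    finally show "(\<Sum>i<k. (\<nu> \<circ> \<pi>) i) \<le> (\<Sum>i<k. \<mu> i)" .
  qed
qed

text \<open>The leading monomial has coefficient exactly 1: it occurs once in the orbit sum of \<mu>
  and in no other orbit sum, since two partitions that are rearrangements of each other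
  coincide.\<close>

lemma is_jack_expansion:
  assumes \<mu>: "\<mu> \<in> partitions n" and p: "is_jack n \<kappa> \<mu> p"
  obtains f where "f \<in> mspan n (lower_exps n \<mu>)" "p = (\<lambda>x. mono_fun n \<mu> x + f x)"
proof -
  define orb where "orb \<nu> = {\<nu> \<circ> \<pi> | \<pi>. \<pi> permutes {..<n}}" for \<nu> :: "nat \<Rightarrow> nat"
  have fin: "finite (orb \<nu>)" for \<nu>
    using finite_permutations[of "{..<n}"] by (simp add: orb_def)
  have sym: "monomial_sym n \<nu> x = (\<Sum>\<alpha>\<in>orb \<nu>. mono_fun n \<alpha> x)" for \<nu> x
    by (simp add: monomial_sym_def orb_def mono_fun_def)
  have low: "\<alpha> \<in> lower_exps n \<mu>"
    if "\<nu> \<in> partitions n" "dominated n \<nu> \<mu>" "\<alpha> \<in> orb \<nu>" "\<alpha> \<noteq> \<mu>" for \<nu> \<alpha>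
    using that monomial_orbit_lower_exps[OF that(1) \<mu> that(2)] by (auto simp: orb_def)
  have \<mu>_orb: "\<mu> \<in> orb \<mu>" unfolding orb_def by (intro CollectI exI[of _ id]) (simp add: permutes_id)
  define J where "J = {\<nu> \<in> partitions n. dominated n \<nu> \<mu> \<and> \<nu> \<noteq> \<mu>}"
  have not_orb: "\<mu> \<notin> orb \<nu>" if \<nu>: "\<nu> \<in> J" for \<nu>
  proof
    assume "\<mu> \<in> orb \<nu>"
    then obtain \<pi> where \<pi>: "\<pi> permutes {..<n}" "\<mu> = \<nu> \<circ> \<pi>" by (auto simp: orb_def)
    \<comment> \<open>Dominance bounds the initial sums of \<nu> by those of \<mu>; conversely \<mu>
      rearranges the weakly decreasing \<nu>.\<close>
    have eq: "(\<Sum>i<k. \<nu> i) = (\<Sum>i<k. \<mu> i)" if k: "k \<le> n" for k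
    proof (rule antisym)
      show "(\<Sum>i<k. \<nu> i) \<le> (\<Sum>i<k. \<mu> i)" using \<nu> k by (simp add: J_def dominated_def)
      have inj: "inj_on \<pi> {..<k}" using permutes_inj[OF \<pi>(1)] by (rule inj_on_subset) simp
      have "(\<Sum>i<k. \<mu> i) = sum \<nu> (\<pi> ` {..<k})"
        by (simp add: sum.reindex[OF inj] \<pi>(2))
      also have "\<dots> \<le> (\<Sum>i<k. \<nu> i)"
        using sum_antimono_le_initial[of \<nu> "\<pi> ` {..<k}"] \<nu> card_image[OF inj]
        by (simp add: partitions_def J_def)
      finally show "(\<Sum>i<k. \<mu> i) \<le> (\<Sum>i<k. \<nu> i)" .
    qed
    have "\<nu> i = \<mu> i" if "i < n" for i
      using eq[of "Suc i"] eq[of i] that by simp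
    moreover have "\<nu> i = \<mu> i" if "i \<ge> n" for i
      using \<nu> \<mu> that by (simp add: J_def partitions_def)
    ultimately have "\<nu> = \<mu>" by (metis ext not_less)
    thus False using \<nu> by (simp add: J_def)
  qed
  obtain c where c: "p = (\<lambda>x. monomial_sym n \<mu> x + (\<Sum>\<nu>\<in>J. c \<nu> * monomial_sym n \<nu> x))"
    using p by (auto simp: is_jack_def J_def)
  define f where "f x = (\<Sum>\<alpha>\<in>orb \<mu> - {\<mu>}. mono_fun n \<alpha> x) +
    (\<Sum>\<nu>\<in>J. c \<nu> * (\<Sum>\<alpha>\<in>orb \<nu>. mono_fun n \<alpha> x))" for x
  have "f \<in> mspan n (lower_exps n \<mu>)" unfolding f_def
  proof (intro mspan_add mspan_sum mspan_scale mspan_mono_fun)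
    show "\<alpha> \<in> lower_exps n \<mu>" if "\<alpha> \<in> orb \<mu> - {\<mu>}" for \<alpha>
      using low[of \<mu> \<alpha>] that \<mu> by (auto simp: dominated_def)
    show "\<alpha> \<in> lower_exps n \<mu>" if "\<nu> \<in> J" "\<alpha> \<in> orb \<nu>" for \<nu> \<alpha>
      using low[of \<nu> \<alpha>] not_orb[OF that(1)] that by (auto simp: J_def)
  qed
  moreover have "p = (\<lambda>x. mono_fun n \<mu> x + f x)"
    unfolding c f_def sym by (simp add: sum.remove[OF fin \<mu>_orb] add.assoc)
  ultimately show thesis by (rule that)
qed

section \<open>Asymptotics along a curve\<close>

text \<open>For \<open>y\<close> strictly decreasing below n, each coordinate outgrows the later
  ones as \<open>s\<close> tends to infinity. Growth rates then single out leading monomials;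
  \<open>expo\<close> is the rate of a monomial.\<close>

definition curve :: "(nat \<Rightarrow> nat) \<Rightarrow> real \<Rightarrow> nat \<Rightarrow> complex" where
  "curve y s = (\<lambda>i. of_real s ^ y i)"

definition expo :: "nat \<Rightarrow> (nat \<Rightarrow> nat) \<Rightarrow> (nat \<Rightarrow> nat) \<Rightarrow> nat" where
  "expo n y \<alpha> = (\<Sum>i<n. y i * \<alpha> i)"

lemma mono_fun_curve: "mono_fun n \<alpha> (curve y s) = of_real s ^ expo n y \<alpha>"
  by (simp add: mono_fun_def curve_def expo_def power_mult power_sum)

lemma power_ratio_tendsto_0:
  assumes "a < b"
  shows "((\<lambda>s. complex_of_real s ^ a / of_real s ^ b) \<longlongrightarrow> 0) at_top"
proof -
  have "((\<lambda>s::real. inverse s ^ (b - a)) \<longlongrightarrow> 0 ^ (b - a)) at_top"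
    by (intro tendsto_power tendsto_inverse_0_at_top filterlim_ident)
  hence "((\<lambda>s. complex_of_real (inverse s ^ (b - a))) \<longlongrightarrow> of_real 0) at_top"
    using assms by (intro tendsto_of_real) (simp add: zero_power)
  moreover have "\<forall>\<^sub>F s in at_top. complex_of_real (inverse s ^ (b - a)) = of_real s ^ a / of_real s ^ b"
    using eventually_gt_at_top[of 0]
    by eventually_elim (use assms in \<open>simp add: power_diff field_simps\<close>)
  ultimately show ?thesis by (simp add: tendsto_cong)
qed

lemma curve_ratio_tendsto:
  assumes "\<And>i j. i < j \<Longrightarrow> j < n \<Longrightarrow> y j < y i" "i < n" "j < n" "i \<noteq> j"
  shows "((\<lambda>s. curve y s i / (curve y s i - curve y s j)) \<longlongrightarrow> (if i < j then 1 else 0)) at_top"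
proof (cases "i < j")
  case True
  have "((\<lambda>s. 1 / (1 - complex_of_real s ^ y j / of_real s ^ y i)) \<longlongrightarrow> 1 / (1 - 0)) at_top"
    using assms True by (intro tendsto_intros power_ratio_tendsto_0) auto
  moreover have "\<forall>\<^sub>F s in at_top. 1 / (1 - complex_of_real s ^ y j / of_real s ^ y i) =
      curve y s i / (curve y s i - curve y s j)"
    using eventually_gt_at_top[of 0]
    by eventually_elim (simp add: curve_def divide_simps)
  ultimately show ?thesis using True by (simp add: tendsto_cong)
next
  case False
  hence "j < i" using assms by simp
  have "((\<lambda>s. (complex_of_real s ^ y i / of_real s ^ y j) /
      (complex_of_real s ^ y i / of_real s ^ y j - 1)) \<longlongrightarrow> 0 / (0 - 1)) at_top"
    using assms \<open>j < i\<close> by (intro tendsto_intros power_ratio_tendsto_0) auto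
  moreover have "\<forall>\<^sub>F s in at_top. (complex_of_real s ^ y i / of_real s ^ y j) /
      (complex_of_real s ^ y i / of_real s ^ y j - 1) =
      curve y s i / (curve y s i - curve y s j)"
    using eventually_gt_at_top[of 0]
    by eventually_elim (simp add: curve_def divide_simps)
  ultimately show ?thesis using False by (simp add: tendsto_cong)
qed

text \<open>The ratios x_i / (x_i - x_j) tend to 1 for j > i and to 0 for j < i. Index i thus
  contributes n - 1 - i ones, which is the factor of 2 \<kappa> in
  \<open>d_eigenvalue\<close>.\<close>

lemma D2_mono_fun_curve:
  assumes "\<And>i j. i < j \<Longrightarrow> j < n \<Longrightarrow> y j < y i"
  shows "((\<lambda>s. D2 n \<kappa> (mono_fun n \<alpha>) (curve y s) / of_real s ^ expo n y \<alpha>) \<longlongrightarrow>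
    of_real (d_eigenvalue n \<kappa> \<alpha>)) at_top"
proof -
  define h where "h s = (\<Sum>i<n. of_nat (\<alpha> i) * of_nat (\<alpha> i - 1)) + 2 * of_real \<kappa> *
    (\<Sum>i<n. \<Sum>j\<in>{..<n} - {i}. curve y s i / (curve y s i - curve y s j) * of_nat (\<alpha> i))" for s
  have "(h \<longlongrightarrow> (\<Sum>i<n. of_nat (\<alpha> i) * of_nat (\<alpha> i - 1)) + 2 * of_real \<kappa> *
    (\<Sum>i<n. \<Sum>j\<in>{..<n} - {i}. (if i < j then 1 else 0) * of_nat (\<alpha> i))) at_top"
    unfolding h_def by (intro tendsto_intros curve_ratio_tendsto[OF assms]) auto
  also have "(\<Sum>i<n. of_nat (\<alpha> i) * of_nat (\<alpha> i - 1)) + 2 * of_real \<kappa> *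
    (\<Sum>i<n. \<Sum>j\<in>{..<n} - {i}. (if i < j then 1 else 0) * of_nat (\<alpha> i)) =
    complex_of_real (d_eigenvalue n \<kappa> \<alpha>)"
  proof -
    have "(\<Sum>j\<in>{..<n} - {i}. (if i < j then 1 else 0) * of_nat (\<alpha> i)) =
        (of_nat n - 1 - of_nat i) * (of_nat (\<alpha> i) :: complex)" if "i < n" for i
    proof -
      have "(\<Sum>j\<in>{..<n} - {i}. if i < j then 1 else 0 :: complex) = (\<Sum>j\<in>{i<..<n}. 1)"
        by (rule sum.mono_neutral_cong_right) auto
      also have "\<dots> = of_nat n - 1 - of_nat i" using that by (simp add: of_nat_diff)
      finally show ?thesis by (simp flip: sum_distrib_right)
    qed
    hence "(\<Sum>i<n. \<Sum>j\<in>{..<n} - {i}. (if i < j then 1 else 0) * of_nat (\<alpha> i)) =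
        (\<Sum>i<n. (of_nat n - 1 - of_nat i) * (of_nat (\<alpha> i) :: complex))"
      by (intro sum.cong) auto
    moreover have "of_nat (\<alpha> i) * (of_nat (\<alpha> i - 1) :: complex) =
        of_nat (\<alpha> i) * (of_nat (\<alpha> i) - 1)" for i
      by (cases "\<alpha> i") auto
    ultimately show ?thesis
      by (simp only:) (simp add: d_eigenvalue_def sum_distrib_left sum.distrib[symmetric] algebra_simps)
  qed
  finally have "(h \<longlongrightarrow> of_real (d_eigenvalue n \<kappa> \<alpha>)) at_top" .
  moreover have "\<forall>\<^sub>F s in at_top. h s = D2 n \<kappa> (mono_fun n \<alpha>) (curve y s) / of_real s ^ expo n y \<alpha>"
    using eventually_gt_at_top[of 0]
    by eventually_elim (simp add: D2_mono_fun mono_fun_curve h_def)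
  ultimately show ?thesis by (simp add: tendsto_cong)
qed

text \<open>Growth below \<open>s ^ M\<close> is preserved by \<open>D2\<close>, which acts on each
  monomial asymptotically as a constant.\<close>

lemma mspan_curve_tendsto_0:
  assumes y: "\<And>i j. i < j \<Longrightarrow> j < n \<Longrightarrow> y j < y i"
    and f: "f \<in> mspan n {\<alpha>. expo n y \<alpha> < M}"
  shows "((\<lambda>s. f (curve y s) / of_real s ^ M) \<longlongrightarrow> 0) at_top"
    and "((\<lambda>s. D2 n \<kappa> f (curve y s) / of_real s ^ M) \<longlongrightarrow> 0) at_top"
proof -
  show "((\<lambda>s. f (curve y s) / of_real s ^ M) \<longlongrightarrow> 0) at_top"
    using f
  proof induction
    case (step f \<alpha> c)
    have "((\<lambda>s. f (curve y s) / of_real s ^ M +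
        c * (complex_of_real s ^ expo n y \<alpha> / of_real s ^ M)) \<longlongrightarrow> 0 + c * 0) at_top"
      using step by (intro tendsto_intros power_ratio_tendsto_0) auto
    thus ?case by (simp add: mono_fun_curve add_divide_distrib)
  qed simp
  show "((\<lambda>s. D2 n \<kappa> f (curve y s) / of_real s ^ M) \<longlongrightarrow> 0) at_top"
    using f
  proof induction
    case zero
    show ?case by (simp add: D2_diff_op diff_op_zero)
  next
    case (step f \<alpha> c)
    have "((\<lambda>s. D2 n \<kappa> f (curve y s) / of_real s ^ M +
        c * (D2 n \<kappa> (mono_fun n \<alpha>) (curve y s) / of_real s ^ expo n y \<alpha> *
          (complex_of_real s ^ expo n y \<alpha> / of_real s ^ M)))
        \<longlongrightarrow> 0 + c * (of_real (d_eigenvalue n \<kappa> \<alpha>) * 0)) at_top"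
      using step by (intro tendsto_intros power_ratio_tendsto_0 D2_mono_fun_curve y) auto
    moreover have "\<forall>\<^sub>F s in at_top. D2 n \<kappa> f (curve y s) / of_real s ^ M +
        c * (D2 n \<kappa> (mono_fun n \<alpha>) (curve y s) / of_real s ^ expo n y \<alpha> *
          (complex_of_real s ^ expo n y \<alpha> / of_real s ^ M)) =
        D2 n \<kappa> (\<lambda>x. f x + c * mono_fun n \<alpha> x) (curve y s) / of_real s ^ M"
      using eventually_gt_at_top[of 0]
    proof eventually_elim
      case (elim s)
      have "D2 n \<kappa> (\<lambda>x. f x + c * mono_fun n \<alpha> x) x =
          D2 n \<kappa> f x + c * D2 n \<kappa> (mono_fun n \<alpha>) x" for x
        unfolding D2_diff_op
        by (intro diff_op_add_scale mspan_poly_in[OF step.hyps(1)] poly_in_mono_fun)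
      thus ?case using elim by (simp add: add_divide_distrib)
    qed
    ultimately show ?case by (simp add: tendsto_cong)
  qed
qed

text \<open>The leading monomial outgrows all others, also after \<open>D2\<close> is applied, so
  its coefficient and its \<open>D2\<close> factor are the limits.\<close>

lemma is_jack_curve_tendsto:
  assumes \<mu>: "\<mu> \<in> partitions n" and p: "is_jack n \<kappa> \<mu> p"
    and y: "\<And>i j. i < j \<Longrightarrow> j < n \<Longrightarrow> y j < y i"
  shows "((\<lambda>s. p (curve y s) / of_real s ^ expo n y \<mu>) \<longlongrightarrow> 1) at_top"
    and "((\<lambda>s. D2 n \<kappa> p (curve y s) / of_real s ^ expo n y \<mu>) \<longlongrightarrow> of_real (d_eigenvalue n \<kappa> \<mu>)) at_top"
proof -
  obtain f where f: "f \<in> mspan n (lower_exps n \<mu>)" "p = (\<lambda>x. mono_fun n \<mu> x + f x)"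
    using is_jack_expansion[OF \<mu> p] .
  have "lower_exps n \<mu> \<subseteq> {\<alpha>. expo n y \<alpha> < expo n y \<mu>}"
    using y by (auto simp: lower_exps_def expo_def)
  hence f': "f \<in> mspan n {\<alpha>. expo n y \<alpha> < expo n y \<mu>}" using f(1) by (rule mspan_mono)
  have pos: "\<forall>\<^sub>F s::real in at_top. s > 0" by (rule eventually_gt_at_top)
  have "((\<lambda>s. 1 + f (curve y s) / of_real s ^ expo n y \<mu>) \<longlongrightarrow> 1 + 0) at_top"
    by (intro tendsto_intros mspan_curve_tendsto_0[OF y f'])
  moreover have "\<forall>\<^sub>F s in at_top. 1 + f (curve y s) / of_real s ^ expo n y \<mu> =
      p (curve y s) / of_real s ^ expo n y \<mu>"
    using pos by eventually_elim (simp add: f(2) mono_fun_curve add_divide_distrib)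
  ultimately show "((\<lambda>s. p (curve y s) / of_real s ^ expo n y \<mu>) \<longlongrightarrow> 1) at_top"
    by (simp add: tendsto_cong)
  have "((\<lambda>s. D2 n \<kappa> (mono_fun n \<mu>) (curve y s) / of_real s ^ expo n y \<mu> +
      D2 n \<kappa> f (curve y s) / of_real s ^ expo n y \<mu>) \<longlongrightarrow>
      of_real (d_eigenvalue n \<kappa> \<mu>) + 0) at_top"
    by (intro tendsto_intros mspan_curve_tendsto_0[OF y f'] D2_mono_fun_curve y)
  moreover have "D2 n \<kappa> p x = D2 n \<kappa> (mono_fun n \<mu>) x + D2 n \<kappa> f x" for x
    unfolding D2_diff_op f(2)
    using diff_op_add_scale[of "mono_fun n \<mu>" f n _ _ 1] mspan_poly_in[OF f(1)]
    by (simp add: poly_in_mono_fun)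
  ultimately show "((\<lambda>s. D2 n \<kappa> p (curve y s) / of_real s ^ expo n y \<mu>) \<longlongrightarrow>
      of_real (d_eigenvalue n \<kappa> \<mu>)) at_top"
    by (simp add: add_divide_distrib)
qed

section \<open>Linear independence of Jack polynomials\<close>

text \<open>Proved by Gaussian elimination on the family \<open>f\<close>.\<close>

lemma independent_coeffs_tendsto_0:
  fixes f :: "'i \<Rightarrow> 'x \<Rightarrow> complex" and c :: "'e \<Rightarrow> 'i \<Rightarrow> complex"
  assumes "finite I"
    and "\<And>b i. (\<And>x. x \<in> S \<Longrightarrow> (\<Sum>i\<in>I. b i * f i x) = 0) \<Longrightarrow> i \<in> I \<Longrightarrow> b i = 0"
    and "\<And>x. x \<in> S \<Longrightarrow> ((\<lambda>e. \<Sum>i\<in>I. c e i * f i x) \<longlongrightarrow> 0) F"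
    and "i \<in> I"
  shows "((\<lambda>e. c e i) \<longlongrightarrow> 0) F"
  using assms
proof (induction I arbitrary: f i rule: finite_induct)
  case (insert k I)
  note indep = insert.prems(1) and conv = insert.prems(2)
  \<comment> \<open>A pivot exists: otherwise the coefficient family that is 1 at \<open>k\<close>
    and 0 elsewhere would contradict independence.\<close>
  have "\<exists>x\<in>S. f k x \<noteq> 0"
  proof (rule ccontr)
    assume "\<not> (\<exists>x\<in>S. f k x \<noteq> 0)"
    hence "(\<Sum>i\<in>insert k I. (if i = k then 1 else 0) * f i x) = 0" if "x \<in> S" for x
      using that by (intro sum.neutral) auto
    from indep[OF this, of k] show False by simp
  qed
  then obtain x0 where x0: "x0 \<in> S" "f k x0 \<noteq> 0" by blast
  \<comment> \<open>Each \<open>g i\<close> vanishes at the pivot point \<open>x0\<close>, so the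
    family on \<open>I\<close> no longer involves the unknown coefficient of
    \<open>k\<close>.\<close>
  define g where "g i x = f i x - f i x0 / f k x0 * f k x" for i x
  have g_sum: "(\<Sum>i\<in>I. b i * g i x) =
      (\<Sum>i\<in>I. b i * f i x) - (\<Sum>i\<in>I. b i * f i x0) / f k x0 * f k x" for b x
    by (simp add: g_def right_diff_distrib sum_subtractf sum_divide_distrib sum_distrib_right mult.assoc)
  have conv_I: "((\<lambda>e. c e i) \<longlongrightarrow> 0) F" if "i \<in> I" for i
  proof (rule insert.IH[of g])
    fix b i
    assume b: "\<And>x. x \<in> S \<Longrightarrow> (\<Sum>i\<in>I. b i * g i x) = 0" and i: "i \<in> I"
    \<comment> \<open>A relation among the \<open>g i\<close> lifts to one among the
      \<open>f i\<close>; the value at \<open>k\<close> collects the subtracted multiples of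
      \<open>f k\<close>.\<close>
    define b' where "b' = b(k := - (\<Sum>i\<in>I. b i * f i x0) / f k x0)"
    have "(\<Sum>i\<in>I. b' i * f i x) = (\<Sum>i\<in>I. b i * f i x)" for x
      using insert.hyps by (intro sum.cong) (auto simp: b'_def)
    hence "(\<Sum>i\<in>insert k I. b' i * f i x) = 0" if "x \<in> S" for x
      using b[OF that] insert.hyps unfolding g_sum by (simp add: b'_def)
    from indep[OF this, of i] show "b i = 0"
      using i insert.hyps by (auto simp: b'_def split: if_splits)
  next
    fix x assume x: "x \<in> S"
    have "((\<lambda>e. (\<Sum>i\<in>insert k I. c e i * f i x) -
        (\<Sum>i\<in>insert k I. c e i * f i x0) / f k x0 * f k x) \<longlongrightarrow> 0 - 0 / f k x0 * f k x) F"
      by (intro tendsto_intros conv x x0)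
    thus "((\<lambda>e. \<Sum>i\<in>I. c e i * g i x) \<longlongrightarrow> 0) F"
      unfolding g_sum using insert.hyps x0(2) by (simp add: add_divide_distrib ring_distribs)
  qed fact
  show ?case
  proof (cases "i = k")
    case True
    \<comment> \<open>Back substitution: the coefficient of \<open>k\<close> is solved for at the
      pivot point.\<close>
    have "((\<lambda>e. ((\<Sum>i\<in>insert k I. c e i * f i x0) - (\<Sum>i\<in>I. c e i * f i x0)) / f k x0)
        \<longlongrightarrow> (0 - (\<Sum>i\<in>I. 0 * f i x0)) / f k x0) F"
      by (intro tendsto_intros conv conv_I x0)
    thus ?thesis using True x0(2) insert.hyps by simp
  qed (use insert.prems(3) conv_I in auto)
qed simp

section \<open>Partitions contained in \<open>lam\<close>, and generic points\<close>

definition contained :: "nat \<Rightarrow> (nat \<Rightarrow> nat) \<Rightarrow> (nat \<Rightarrow> nat) set" where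
  "contained n lam = {mu \<in> partitions n. mu \<le> lam}"

text \<open>A zero coordinate x_i corresponds to sinh (z_i / 2) = 0, where \<open>DBC\<close> is
  singular. The set is stable under nonzero scaling; the further singular value -4 \<delta> depends
  on \<delta> and is excluded separately.\<close>

definition generic_points :: "nat \<Rightarrow> (nat \<Rightarrow> complex) set" where
  "generic_points n = {x \<in> regular_points n. \<forall>i<n. x i \<noteq> 0}"

lemma contained_bound:
  assumes "lam \<in> partitions n" "mu \<in> contained n lam"
  shows "mu i \<le> lam 0"
proof -
  have "mu i \<le> lam i" using assms by (simp add: contained_def le_fun_def)
  also have "\<dots> \<le> lam 0" using assms by (auto simp: partitions_def dest: antimonoD)
  finally show ?thesis .
qed

lemma finite_contained:
  assumes "lam \<in> partitions n"
  shows "finite (contained n lam)"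
proof (rule finite_subset)
  show "contained n lam \<subseteq> {f. \<forall>i. (i \<in> {..<n} \<longrightarrow> f i \<in> {..lam 0}) \<and> (i \<notin> {..<n} \<longrightarrow> f i = 0)}"
    using contained_bound[OF assms] by (auto simp: contained_def partitions_def)
  show "finite {f. \<forall>i. (i \<in> {..<n} \<longrightarrow> f i \<in> {..lam 0}) \<and> (i \<notin> {..<n} \<longrightarrow> f i = 0)}"
    by (rule finite_set_of_finite_funs) auto
qed

lemma weight_contained:
  assumes "mu \<in> contained n lam" "lam \<in> partitions n"
  shows "weight n mu \<le> weight n lam"
    and "weight n mu = weight n lam \<Longrightarrow> mu = lam"
proof -
  have le: "mu i \<le> lam i" for i using assms by (simp add: contained_def le_fun_def)
  show "weight n mu \<le> weight n lam" unfolding weight_def by (intro sum_mono le)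
  assume eq: "weight n mu = weight n lam"
  have "mu i = lam i" for i
  proof (cases "i < n")
    case True
    show ?thesis
    proof (rule ccontr)
      assume "mu i \<noteq> lam i"
      hence "weight n mu < weight n lam"
        unfolding weight_def using True le
        by (intro sum_strict_mono_ex1) (auto simp: le_less)
      thus False using eq by simp
    qed
  next
    case False
    thus ?thesis using assms by (simp add: contained_def partitions_def)
  qed
  thus "mu = lam" by blast
qed

text \<open>Uniqueness of base \<open>B\<close> digits, most significant first; the induction splits
  off the units digit by \<open>mod\<close> and \<open>div\<close>.\<close>

lemma base_expansion_unique:
  fixes \<alpha> \<beta> :: "nat \<Rightarrow> nat"
  assumes "\<And>i. \<alpha> i < B" "\<And>i. \<beta> i < B"
    and "(\<Sum>i<n. B ^ (n - 1 - i) * \<alpha> i) = (\<Sum>i<n. B ^ (n - 1 - i) * \<beta> i)" "i < n"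
  shows "\<alpha> i = \<beta> i"
  using assms(3,4)
proof (induction n arbitrary: i)
  case (Suc n)
  have split: "(\<Sum>i<Suc n. B ^ (Suc n - 1 - i) * \<gamma> i) =
      B * (\<Sum>i<n. B ^ (n - 1 - i) * \<gamma> i) + \<gamma> n" for \<gamma>
  proof -
    have "B ^ (n - i) = B * B ^ (n - 1 - i)" if "i < n" for i
      using that by (simp add: Suc_diff_Suc flip: power_Suc)
    thus ?thesis by (simp add: sum_distrib_left mult.assoc)
  qed
  have "(B * u + \<alpha> n) mod B = \<alpha> n" "(B * u + \<beta> n) mod B = \<beta> n"
    "(B * u + \<alpha> n) div B = u" "(B * u + \<beta> n) div B = u" for u
    using assms(1,2)[of n] by auto
  with Suc.prems(1)[unfolded split] have "\<alpha> n = \<beta> n"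
    and "(\<Sum>i<n. B ^ (n - 1 - i) * \<alpha> i) = (\<Sum>i<n. B ^ (n - 1 - i) * \<beta> i)"
    by metis+
  thus ?case using Suc by (cases "i = n") auto
qed simp

lemma curve_generic:
  assumes y: "\<And>i j. i < j \<Longrightarrow> j < n \<Longrightarrow> y j < y i" and s: "s > 1"
  shows "curve y s \<in> generic_points n"
proof -
  have "curve y s i \<noteq> curve y s j" if "i < j" "j < n" for i j
  proof
    assume "curve y s i = curve y s j"
    hence "complex_of_real (s ^ y i) = complex_of_real (s ^ y j)" by (simp add: curve_def)
    hence "s ^ y i = s ^ y j" by (simp only: of_real_eq_iff)
    thus False using y[OF that] s by (simp add: power_inject_exp)
  qed
  hence "curve y s i \<noteq> curve y s j" if "i \<noteq> j" "i < n" "j < n" for i j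
    using that by (metis nat_neq_iff)
  thus ?thesis using s by (auto simp: generic_points_def regular_points_def curve_def)
qed

text \<open>Since \<open>jack\<close> is a definite description, its defining property has to be
  supplied; well-definedness of the Bessel polynomial gives it for all partitions inside
  \<open>lam\<close>.\<close>

locale jack_family =
  fixes n :: nat and \<kappa> :: real and lam :: "nat \<Rightarrow> nat"
  assumes lam: "lam \<in> partitions n"
    and is_jack: "mu \<in> contained n lam \<Longrightarrow> is_jack n \<kappa> mu (jack n \<kappa> mu)"
begin

abbreviation P :: "(nat \<Rightarrow> nat) \<Rightarrow> (nat \<Rightarrow> complex) \<Rightarrow> complex" where
  "P \<equiv> jack n \<kappa>"

lemma lam_contained: "lam \<in> contained n lam"
  using lam by (simp add: contained_def)

text \<open>Along a curve that gives distinct partitions distinct growth rates, the fastest term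
  with nonzero coefficient cannot be cancelled by the others.\<close>

lemma jack_independent:
  assumes J: "J \<subseteq> contained n lam"
    and zero: "\<And>x. x \<in> generic_points n \<Longrightarrow> (\<Sum>mu\<in>J. b mu * P mu x) = 0"
    and "nu \<in> J"
  shows "b nu = 0"
proof (rule ccontr)
  assume "b nu \<noteq> 0"
  \<comment> \<open>The parts are digits in base \<open>B\<close>, so distinct partitions have distinct leading powers of \<open>s\<close>.\<close>
  define B where "B = lam 0 + 2"
  define y where "y i = B ^ (n - 1 - i)" for i
  \<comment> \<open>The base \<open>lam 0 + 2\<close> exceeds 1 even when \<open>lam 0 = 0\<close>,
    so its powers increase strictly.\<close>
  have y: "y j < y i" if "i < j" "j < n" for i j
    unfolding y_def using that by (intro power_strict_increasing) (auto simp: B_def)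
  have inj: "mu = mu'" if "mu \<in> J" "mu' \<in> J" "expo n y mu = expo n y mu'" for mu mu'
  proof
    fix i
    have "mu i < B" "mu' i < B" for i
      using contained_bound[OF lam, of mu i] contained_bound[OF lam, of mu' i] J that
      by (auto simp: B_def)
    from base_expansion_unique[where \<alpha> = mu and \<beta> = mu', OF this, of n i] that(3)
    have "mu i = mu' i" if "i < n"
      using that by (simp add: expo_def y_def)
    moreover have "mu i = 0" "mu' i = 0" if "n \<le> i"
      using that \<open>mu \<in> J\<close> \<open>mu' \<in> J\<close> J by (auto simp: contained_def partitions_def)
    ultimately show "mu i = mu' i" by (cases "i < n") auto
  qed
  have fin: "finite J" using J finite_contained[OF lam] by (rule finite_subset)
  define K where "K = {mu \<in> J. b mu \<noteq> 0}"
  have "finite K" "K \<noteq> {}" using fin \<open>b nu \<noteq> 0\<close> \<open>nu \<in> J\<close> by (auto simp: K_def)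
  hence "Max (expo n y ` K) \<in> expo n y ` K" by (intro Max_in) auto
  then obtain m where "m \<in> K" "Max (expo n y ` K) = expo n y m" by blast
  with \<open>finite K\<close> have m: "m \<in> K" "\<And>mu. mu \<in> K \<Longrightarrow> expo n y mu \<le> expo n y m"
    by (metis Max_ge finite_imageI imageI)+
  define M where "M = expo n y m"
  \<comment> \<open>After division by the largest rate, every term except that of \<open>m\<close>
    tends to 0, and that one tends to \<open>b m\<close>.\<close>
  have "((\<lambda>s. \<Sum>mu\<in>J. b mu * (P mu (curve y s) / of_real s ^ M)) \<longlongrightarrow>
      (\<Sum>mu\<in>J. if mu = m then b m else 0)) at_top"
  proof (rule tendsto_sum)
    fix mu assume mu: "mu \<in> J"
    note mu' = mu[THEN subsetD[OF J]]
    have part: "mu \<in> partitions n" using mu' by (simp add: contained_def)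
    note lim = is_jack_curve_tendsto(1)[OF part is_jack[OF mu'] y]
    show "((\<lambda>s. b mu * (P mu (curve y s) / of_real s ^ M)) \<longlongrightarrow> (if mu = m then b m else 0)) at_top"
    proof (cases "mu = m \<or> b mu = 0")
      case True
      have "((\<lambda>s. b mu * (P mu (curve y s) / of_real s ^ M)) \<longlongrightarrow> b m * 1) at_top" if "mu = m"
        using lim unfolding that M_def by (intro tendsto_intros)
      thus ?thesis using True by auto
    next
      case False
      hence "mu \<in> K" using mu by (simp add: K_def)
      hence "expo n y mu < M" using m(2) inj[of mu m] mu m(1) False
        by (force simp: M_def K_def le_less)
      with lim have "((\<lambda>s. b mu * (P mu (curve y s) / of_real s ^ expo n y mu *
          (of_real s ^ expo n y mu / of_real s ^ M))) \<longlongrightarrow> b mu * (1 * 0)) at_top"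
        by (intro tendsto_intros power_ratio_tendsto_0)
      moreover have "\<forall>\<^sub>F s in at_top. b mu * (P mu (curve y s) / of_real s ^ expo n y mu *
          (of_real s ^ expo n y mu / of_real s ^ M)) = b mu * (P mu (curve y s) / of_real s ^ M)"
        using eventually_gt_at_top[of 0] by eventually_elim simp
      ultimately have "((\<lambda>s. b mu * (P mu (curve y s) / of_real s ^ M)) \<longlongrightarrow> b mu * (1 * 0)) at_top"
        by (rule Lim_transform_eventually)
      thus ?thesis using False by simp
    qed
  qed
  moreover have "\<forall>\<^sub>F s in at_top. (\<Sum>mu\<in>J. b mu * (P mu (curve y s) / of_real s ^ M)) = 0"
    using eventually_gt_at_top[of 1]
  proof eventually_elim
    case (elim s)
    have "(\<Sum>mu\<in>J. b mu * (P mu (curve y s) / of_real s ^ M)) =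
        (\<Sum>mu\<in>J. b mu * P mu (curve y s)) / of_real s ^ M"
      by (simp add: sum_divide_distrib)
    also have "(\<Sum>mu\<in>J. b mu * P mu (curve y s)) = 0"
      by (intro zero curve_generic[OF y elim])
    finally show ?case by simp
  qed
  ultimately have "((\<lambda>_::real. 0) \<longlongrightarrow> (\<Sum>mu\<in>J. if mu = m then b m else 0)) at_top"
    by (rule Lim_transform_eventually)
  from tendsto_unique[OF _ this tendsto_const] have "(\<Sum>mu\<in>J. if mu = m then b m else 0) = 0"
    by simp
  thus False using fin m(1) by (simp add: K_def sum.delta)
qed

lemma jack_mspan:
  assumes "mu \<in> contained n lam"
  shows "P mu \<in> mspan n {\<alpha>. weight n \<alpha> = weight n mu}"
proof -
  obtain f where f: "f \<in> mspan n (lower_exps n mu)" "P mu = (\<lambda>x. mono_fun n mu x + f x)"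
    using is_jack_expansion is_jack[OF assms] assms
    by (metis (no_types, lifting) contained_def mem_Collect_eq)
  have "lower_exps n mu \<subseteq> {\<alpha>. weight n \<alpha> = weight n mu}" by (auto simp: lower_exps_def)
  with f(1) show ?thesis unfolding f(2)
    by (intro mspan_add mspan_mono_fun) (auto intro: mspan_mono)
qed

text \<open>The definition only asserts that some eigenvalue \<open>c\<close> exists; comparing
  leading terms along a curve identifies it.\<close>

lemma jack_D2:
  assumes mu: "mu \<in> contained n lam" and x: "x \<in> regular_points n"
  shows "D2 n \<kappa> (P mu) x = of_real (d_eigenvalue n \<kappa> mu) * P mu x"
proof -
  obtain c where c: "\<And>x. x \<in> regular_points n \<Longrightarrow> D2 n \<kappa> (P mu) x = c * P mu x"
    using is_jack[OF mu] by (auto simp: is_jack_def eigenfunction_on_def)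
  define y where "y i = n - i" for i :: nat
  have y: "y j < y i" if "i < j" "j < n" for i j using that by (simp add: y_def)
  have part: "mu \<in> partitions n" using mu by (simp add: contained_def)
  note lim = is_jack_curve_tendsto[OF part is_jack[OF mu] y]
  have "((\<lambda>s. c * (P mu (curve y s) / of_real s ^ expo n y mu)) \<longlongrightarrow> c * 1) at_top"
    by (intro tendsto_intros lim)
  moreover have "\<forall>\<^sub>F s in at_top. c * (P mu (curve y s) / of_real s ^ expo n y mu) =
      D2 n \<kappa> (P mu) (curve y s) / of_real s ^ expo n y mu"
    using eventually_gt_at_top[of 1]
  proof eventually_elim
    case (elim s)
    have "curve y s \<in> regular_points n"
      using curve_generic[OF y elim] by (simp add: generic_points_def)
    thus ?case by (simp add: c)
  qed
  ultimately have "((\<lambda>s. D2 n \<kappa> (P mu) (curve y s) / of_real s ^ expo n y mu) \<longlongrightarrow> c * 1) at_top"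
    by (rule Lim_transform_eventually)
  from tendsto_unique[OF _ this lim(2)] have "c = of_real (d_eigenvalue n \<kappa> mu)" by simp
  thus ?thesis using c[OF x] by simp
qed

end

section \<open>The deformed operator\<close>

text \<open>These are the terms of lower degree that \<open>DBC\<close> acquires in the coordinates
  \<open>scaled_coord\<close>. The constant is \<delta> (2 + 4 k1 + 4 k2), where 4 k1 + 4 k2 = 3 (a
  - 1) + 2 / \<delta> for the parameters in question.\<close>

definition lower_op ::
  "nat \<Rightarrow> real \<Rightarrow> real \<Rightarrow> complex \<Rightarrow> ((nat \<Rightarrow> complex) \<Rightarrow> complex) \<Rightarrow> (nat \<Rightarrow> complex) \<Rightarrow> complex" where
  "lower_op n a \<kappa> \<delta> = diff_op n (\<lambda>i x. 4 * \<delta> * x i)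
     (\<lambda>i x. 2 + (3 * of_real a - 1) * \<delta> +
        8 * of_real \<kappa> * \<delta> * (\<Sum>j\<in>{..<n} - {i}. x i / (x i - x j)))"

definition deformed_op ::
  "nat \<Rightarrow> real \<Rightarrow> real \<Rightarrow> complex \<Rightarrow> ((nat \<Rightarrow> complex) \<Rightarrow> complex) \<Rightarrow> (nat \<Rightarrow> complex) \<Rightarrow> complex" where
  "deformed_op n a \<kappa> \<delta> f x = D2 n \<kappa> f x + of_real a * euler_op n f x + lower_op n a \<kappa> \<delta> f x"

lemma DB_eq_deformed_op: "DB n a \<kappa> = deformed_op n a \<kappa> 0"
  by (intro ext) (simp add: DB_def deformed_op_def lower_op_def diff_op_def euler_op_def
      distrib_right sum.distrib sum_distrib_left mult.assoc)

lemma deformed_op_sum: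
  assumes "finite I" "\<And>m i. m \<in> I \<Longrightarrow> poly_in i (f m)"
  shows "deformed_op n a \<kappa> \<delta> (\<lambda>x. \<Sum>m\<in>I. c m * f m x) x = (\<Sum>m\<in>I. c m * deformed_op n a \<kappa> \<delta> (f m) x)"
  by (simp add: deformed_op_def lower_op_def D2_diff_op euler_op_diff_op diff_op_sum[OF assms]
      distrib_left sum.distrib sum_distrib_left mult.left_commute)

lemma lower_op_tendsto:
  assumes "(\<delta> \<longlongrightarrow> 0) F"
  shows "((\<lambda>e. lower_op n a \<kappa> (\<delta> e) f x) \<longlongrightarrow> lower_op n a \<kappa> 0 f x) F"
  unfolding lower_op_def diff_op_def by (intro tendsto_intros assms)

text \<open>The extra factor \<open>s\<close> on the left avoids the exponent k - 1, which would be
  truncated at k = 0.\<close>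

lemma lower_op_homogeneous:
  assumes f: "f \<in> mspan n {\<alpha>. weight n \<alpha> = k}" and s: "s \<noteq> 0"
  shows "s * lower_op n a \<kappa> \<delta> f (\<lambda>j. s * x j) = s ^ k * lower_op n a \<kappa> \<delta> f x"
proof -
  note pf = mspan_poly_in[OF f]
  have d1: "partial_deriv i f (\<lambda>j. s * x j) = s ^ k / s * partial_deriv i f x" for i x
    by (rule partial_deriv_homogeneous[OF pf s mspan_homogeneous[OF f]])
  have d2: "partial_deriv i (partial_deriv i f) (\<lambda>j. s * x j) =
      s ^ k / s / s * partial_deriv i (partial_deriv i f) x" for i
    by (rule partial_deriv_homogeneous[OF poly_in_partial_deriv[OF pf] s d1])
  have "s * x i / (s * x i - s * x j) = x i / (x i - x j)" for i j
    using s by (simp flip: right_diff_distrib)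
  thus ?thesis
    unfolding lower_op_def diff_op_def d1 d2 using s
    by (simp add: sum_distrib_left distrib_left mult.assoc mult.left_commute)
qed

text \<open>The sum is a polynomial in \<open>s\<close> with infinitely many zeros. Its coefficient
  at \<open>Suc k\<close> collects \<open>A\<close> from degree k and \<open>B\<close> from degree k
  + 1.\<close>

lemma graded_coefficients:
  fixes A B :: "'i \<Rightarrow> complex"
  assumes "infinite S" "finite I"
    and zero: "\<And>s. s \<in> S \<Longrightarrow> (\<Sum>i\<in>I. A i * s ^ Suc (w i) + B i * s ^ w i) = 0"
  shows "(\<Sum>i\<in>{i\<in>I. w i = k}. A i) + (\<Sum>i\<in>{i\<in>I. w i = Suc k}. B i) = 0"
proof -
  define p where "p = (\<Sum>i\<in>I. monom (A i) (Suc (w i)) + monom (B i) (w i))"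
  have "poly p s = 0" if "s \<in> S" for s
    using zero[OF that] by (simp add: p_def poly_sum poly_monom)
  hence "S \<subseteq> {s. poly p s = 0}" by blast
  hence "p = 0" using poly_roots_finite[of p] \<open>infinite S\<close> finite_subset by blast
  hence "coeff p (Suc k) = 0" by simp
  moreover have "coeff p (Suc k) =
      (\<Sum>i\<in>I. if w i = k then A i else 0) + (\<Sum>i\<in>I. if w i = Suc k then B i else 0)"
    by (simp add: p_def coeff_sum sum.distrib)
  ultimately show ?thesis using \<open>finite I\<close> by (simp add: sum.inter_filter)
qed

section \<open>The recursion for the coefficients and its limit\<close>

context jack_family
begin

text \<open>Degree k of the eigenvalue equation, stated pointwise with the images under
  \<open>lower_op\<close> left unexpanded. The same predicate covers the Jacobi case (\<delta>
  nonzero) and the Bessel case (\<delta> = 0).\<close>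

definition solves_recursion :: "real \<Rightarrow> complex \<Rightarrow> ((nat \<Rightarrow> nat) \<Rightarrow> complex) \<Rightarrow> bool" where
  "solves_recursion a \<delta> v \<longleftrightarrow> v lam = 1 \<and> (\<forall>x\<in>generic_points n. \<forall>k.
     (\<Sum>mu\<in>{mu \<in> contained n lam. weight n mu = k}.
        v mu * (of_real (e_eigenvalue n a \<kappa> lam) - of_real (e_eigenvalue n a \<kappa> mu)) * P mu x) =
     (\<Sum>mu\<in>{mu \<in> contained n lam. weight n mu = Suc k}. v mu * lower_op n a \<kappa> \<delta> (P mu) x))"

text \<open>Evaluating the equation at all multiples \<open>s * x\<close> and comparing powers of
  \<open>s\<close> separates the degrees; the top degree then identifies \<open>c\<close> with the
  eigenvalue attached to \<open>lam\<close>.\<close>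

lemma eigenfunction_solves_recursion:
  assumes eig: "\<And>x. x \<in> generic_points n \<Longrightarrow> (\<forall>i<n. x i \<noteq> - 4 * \<delta>) \<Longrightarrow>
      (\<Sum>mu\<in>contained n lam. v mu * deformed_op n a \<kappa> \<delta> (P mu) x) =
      c * (\<Sum>mu\<in>contained n lam. v mu * P mu x)"
    and v: "v lam = 1"
  shows "solves_recursion a \<delta> v"
proof -
  define E where "E mu = complex_of_real (e_eigenvalue n a \<kappa> mu)" for mu
  have graded: "(\<Sum>mu\<in>{mu \<in> contained n lam. weight n mu = k}. v mu * (E mu - c) * P mu x) +
      (\<Sum>mu\<in>{mu \<in> contained n lam. weight n mu = Suc k}. v mu * lower_op n a \<kappa> \<delta> (P mu) x) = 0"
    if x: "x \<in> generic_points n" for x k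
  proof (rule graded_coefficients[OF _ finite_contained[OF lam]])
    \<comment> \<open>Only finitely many scalings are lost: 0, and those that move some coordinate
      to -4 \<delta>.\<close>
    define S where "S = - ({0} \<union> (\<lambda>i. - 4 * \<delta> / x i) ` {..<n})"
    show "infinite S"
      unfolding S_def by (rule Diff_infinite_finite[of _ UNIV, folded Compl_eq_Diff_UNIV])
        (auto simp: infinite_UNIV_char_0)
    fix s assume "s \<in> S"
    hence s0: "s \<noteq> 0" by (simp add: S_def)
    have s: "s * x i \<noteq> - 4 * \<delta>" if "i < n" for i
    proof
      have xi: "x i \<noteq> 0" using x that by (simp add: generic_points_def)
      assume "s * x i = - 4 * \<delta>"
      hence "s = - 4 * \<delta> / x i"
        by (simp only: nonzero_eq_divide_eq[OF xi])
      thus False using \<open>s \<in> S\<close> that by (auto simp: S_def)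
    qed
    define sx where "sx = (\<lambda>i. s * x i)"
    have sx: "sx \<in> generic_points n" "\<forall>i<n. sx i \<noteq> - 4 * \<delta>"
      using x s s0 by (auto simp: generic_points_def regular_points_def sx_def)
    have op: "s * deformed_op n a \<kappa> \<delta> (P mu) sx =
        E mu * P mu x * s ^ Suc (weight n mu) + lower_op n a \<kappa> \<delta> (P mu) x * s ^ weight n mu"
      if mu: "mu \<in> contained n lam" for mu
    proof -
      note span = jack_mspan[OF mu]
      have "s * lower_op n a \<kappa> \<delta> (P mu) sx = s ^ weight n mu * lower_op n a \<kappa> \<delta> (P mu) x"
        unfolding sx_def by (rule lower_op_homogeneous[OF span s0])
      moreover have "P mu sx = s ^ weight n mu * P mu x"
        unfolding sx_def by (rule mspan_homogeneous[OF span])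
      moreover have "D2 n \<kappa> (P mu) sx = of_real (d_eigenvalue n \<kappa> mu) * P mu sx"
        by (rule jack_D2[OF mu]) (use sx in \<open>simp add: generic_points_def\<close>)
      ultimately show ?thesis
        by (simp add: deformed_op_def euler_op_mspan[OF span] E_def e_eigenvalue_def algebra_simps)
    qed
    have hom: "P mu sx = s ^ weight n mu * P mu x" if "mu \<in> contained n lam" for mu
      unfolding sx_def by (rule mspan_homogeneous[OF jack_mspan[OF that]])
    have "(\<Sum>mu\<in>contained n lam. v mu * (s * deformed_op n a \<kappa> \<delta> (P mu) sx)) =
        (\<Sum>mu\<in>contained n lam. c * v mu * (s * P mu sx))"
      using arg_cong[OF eig[OF sx], of "\<lambda>t. s * t"]
      by (simp add: sum_distrib_left mult.left_commute mult.assoc)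
    hence "(\<Sum>mu\<in>contained n lam. v mu * (s * deformed_op n a \<kappa> \<delta> (P mu) sx) -
        c * v mu * (s * P mu sx)) = 0"
      by (simp add: sum_subtractf)
    also have "(\<Sum>mu\<in>contained n lam. v mu * (s * deformed_op n a \<kappa> \<delta> (P mu) sx) -
        c * v mu * (s * P mu sx)) =
      (\<Sum>mu\<in>contained n lam. v mu * (E mu - c) * P mu x * s ^ Suc (weight n mu) +
        v mu * lower_op n a \<kappa> \<delta> (P mu) x * s ^ weight n mu)"
      by (intro sum.cong refl) (simp add: op hom algebra_simps)
    finally show "(\<Sum>mu\<in>contained n lam. v mu * (E mu - c) * P mu x * s ^ Suc (weight n mu) +
        v mu * lower_op n a \<kappa> \<delta> (P mu) x * s ^ weight n mu) = 0" .
  qed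
  have top: "{mu \<in> contained n lam. weight n mu = weight n lam} = {lam}"
    "{mu \<in> contained n lam. weight n mu = Suc (weight n lam)} = {}"
    using weight_contained[OF _ lam] lam_contained by force+
  \<comment> \<open>In degree |lam| only \<open>lam\<close> itself occurs, and no term arrives from
    a higher degree.\<close>
  have "v lam * (E lam - c) = 0"
  proof (rule jack_independent[of "{lam}" "\<lambda>_. v lam * (E lam - c)" lam])
    show "(\<Sum>mu\<in>{lam}. v lam * (E lam - c) * P mu x) = 0" if "x \<in> generic_points n" for x
      using graded[OF that, of "weight n lam"] unfolding top by simp
  qed (use lam_contained in auto)
  hence c: "c = E lam" using v by simp
  have "(\<Sum>mu\<in>{mu \<in> contained n lam. weight n mu = k}. v mu * (E lam - E mu) * P mu x) =
      (\<Sum>mu\<in>{mu \<in> contained n lam. weight n mu = Suc k}. v mu * lower_op n a \<kappa> \<delta> (P mu) x)"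
    if "x \<in> generic_points n" for x k
  proof -
    have "(\<Sum>mu\<in>{mu \<in> contained n lam. weight n mu = k}. v mu * (E lam - E mu) * P mu x) =
        - (\<Sum>mu\<in>{mu \<in> contained n lam. weight n mu = k}. v mu * (E mu - c) * P mu x)"
      unfolding c sum_negf[symmetric] by (intro sum.cong refl) (simp add: algebra_simps)
    thus ?thesis using graded[OF that, of k] by (simp add: add_eq_0_iff)
  qed
  thus ?thesis using v by (simp add: solves_recursion_def E_def)
qed

text \<open>Once the coefficients of degree k + 1 converge, so does the right-hand side of the
  recursion at every generic point. Independence turns this into convergence of each coefficient
  times its eigenvalue gap, and the gap is nonzero.\<close>

lemma eigenfunction_coeffs_tendsto:
  assumes \<delta>: "(\<delta> \<longlongrightarrow> 0) F"
    and nonres: "\<And>mu. mu \<in> partitions n \<Longrightarrow> mu < lam \<Longrightarrow> e_eigenvalue n a \<kappa> mu \<noteq> e_eigenvalue n a \<kappa> lam"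
    and v: "\<And>e. solves_recursion a (\<delta> e) (v e)" and u: "solves_recursion a 0 u"
    and mu: "mu \<in> contained n lam"
  shows "((\<lambda>e. v e mu) \<longlongrightarrow> u mu) F"
proof -
  define E where "E mu = complex_of_real (e_eigenvalue n a \<kappa> mu)" for mu
  define I where "I k = {mu \<in> contained n lam. weight n mu = k}" for k
  have v_rec: "(\<Sum>mu\<in>I k. v e mu * (E lam - E mu) * P mu x) =
      (\<Sum>mu\<in>I (Suc k). v e mu * lower_op n a \<kappa> (\<delta> e) (P mu) x)"
    and u_rec: "(\<Sum>mu\<in>I k. u mu * (E lam - E mu) * P mu x) =
      (\<Sum>mu\<in>I (Suc k). u mu * lower_op n a \<kappa> 0 (P mu) x)"
    if "x \<in> generic_points n" for e x k
    using that v u by (simp_all add: solves_recursion_def E_def I_def)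
  \<comment> \<open>The index \<open>j\<close> is the codegree, so induction on it descends from
    \<open>lam\<close>.\<close>
  have "mu \<in> contained n lam \<Longrightarrow> weight n mu + j = weight n lam \<Longrightarrow> ((\<lambda>e. v e mu) \<longlongrightarrow> u mu) F" for mu j
  proof (induction j arbitrary: mu)
    case 0
    hence "mu = lam" using weight_contained[OF _ lam] by simp
    thus ?case using u v by (simp add: solves_recursion_def)
  next
    case (Suc j)
    define k where "k = weight n mu"
    have "mu \<noteq> lam" using Suc.prems by auto
    hence "mu < lam" "mu \<in> partitions n"
      using Suc.prems(1) by (auto simp: contained_def)
    hence E_ne: "E lam - E mu \<noteq> 0" using nonres by (force simp: E_def)
    have "((\<lambda>e. (v e mu - u mu) * (E lam - E mu)) \<longlongrightarrow> 0) F"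
    proof (rule independent_coeffs_tendsto_0[where I = "I k" and i = mu and f = P
          and S = "generic_points n" and c = "\<lambda>e mu. (v e mu - u mu) * (E lam - E mu)"])
      show "finite (I k)" using finite_contained[OF lam] by (simp add: I_def)
      show "mu \<in> I k" using Suc.prems by (simp add: I_def k_def)
      show "b i = 0" if "\<And>x. x \<in> generic_points n \<Longrightarrow> (\<Sum>mu\<in>I k. b mu * P mu x) = 0" "i \<in> I k" for b i
        using jack_independent[of "I k" b i] that by (auto simp: I_def)
      fix x assume x: "x \<in> generic_points n"
      have "((\<lambda>e. (\<Sum>mu\<in>I (Suc k). v e mu * lower_op n a \<kappa> (\<delta> e) (P mu) x) -
          (\<Sum>mu\<in>I (Suc k). u mu * lower_op n a \<kappa> 0 (P mu) x)) \<longlongrightarrow>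
          (\<Sum>mu\<in>I (Suc k). u mu * lower_op n a \<kappa> 0 (P mu) x) -
          (\<Sum>mu\<in>I (Suc k). u mu * lower_op n a \<kappa> 0 (P mu) x)) F"
      proof (intro tendsto_intros lower_op_tendsto \<delta>)
        show "((\<lambda>e. v e nu) \<longlongrightarrow> u nu) F" if "nu \<in> I (Suc k)" for nu
          using that Suc.prems by (intro Suc.IH) (auto simp: I_def k_def)
      qed
      thus "((\<lambda>e. \<Sum>mu\<in>I k. (v e mu - u mu) * (E lam - E mu) * P mu x) \<longlongrightarrow> 0) F"
        unfolding v_rec[OF x, symmetric] u_rec[OF x, symmetric]
        by (simp add: sum_subtractf left_diff_distrib)
    qed
    hence "((\<lambda>e. (v e mu - u mu) * (E lam - E mu) / (E lam - E mu) + u mu) \<longlongrightarrow>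
        0 / (E lam - E mu) + u mu) F"
      by (intro tendsto_intros E_ne)
    thus ?case using E_ne by simp
  qed
  from this[OF mu, of "weight n lam - weight n mu"] weight_contained(1)[OF mu lam] show ?thesis
    by simp
qed

end

section \<open>The change of variables\<close>

text \<open>This equals 4 \<delta> sinh^2 (z_i / 2); with \<open>cosh\<close> the derivative is
  simply a multiple of \<open>sinh (z i)\<close>.\<close>

definition scaled_coord :: "complex \<Rightarrow> (nat \<Rightarrow> complex) \<Rightarrow> nat \<Rightarrow> complex" where
  "scaled_coord \<delta> z = (\<lambda>i. 2 * \<delta> * (cosh (z i) - 1))"

lemma cosh_eq_sinh_half: "cosh w = 1 + 2 * (sinh (w / 2))\<^sup>2" for w :: complex
  using cosh_double[of "w / 2"] by (simp add: cosh_square_eq)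

lemma scaled_coord_t_coord: "scaled_coord \<delta> z i = - 4 * \<delta> * t_coord z i"
  by (simp add: scaled_coord_def t_coord_def cosh_eq_sinh_half[of "z i"])

lemma coth_half_mult_sinh:
  assumes "sinh (w / 2) \<noteq> 0"
  shows "coth (w / 2) * sinh w = cosh w + 1"
proof -
  have "cosh w + 1 = 2 * (cosh (w / 2))\<^sup>2"
    using cosh_double[of "w / 2"] by (simp add: cosh_square_eq)
  thus ?thesis
    using assms sinh_double[of "w / 2"] by (simp add: coth_def power2_eq_square)
qed

text \<open>With A and C the half difference and half sum, coth A + coth C = sinh (A + C) / (sinh A
  sinh C), while cosh p - cosh q = 2 sinh A sinh C.\<close>

lemma coth_half_add:
  assumes "sinh ((p - q) / 2) \<noteq> 0" "sinh ((p + q) / 2) \<noteq> 0"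
  shows "coth ((p - q) / 2) + coth ((p + q) / 2) = 2 * sinh p / (cosh p - cosh q)"
    and "cosh p - cosh q \<noteq> 0"
proof -
  define A C where "A = (p - q) / 2" and "C = (p + q) / 2"
  have pq: "p = C + A" "q = C - A" by (simp_all add: A_def C_def field_simps)
  have d: "cosh p - cosh q = 2 * sinh A * sinh C"
    unfolding pq by (simp add: cosh_add cosh_diff)
  have "coth A + coth C = 2 * sinh p / (cosh p - cosh q)"
    unfolding d using assms[folded A_def C_def] unfolding pq
    by (simp add: coth_def sinh_add field_simps)
  thus "coth ((p - q) / 2) + coth ((p + q) / 2) = 2 * sinh p / (cosh p - cosh q)"
    by (simp add: A_def C_def)
  show "cosh p - cosh q \<noteq> 0" unfolding d using assms by (simp add: A_def C_def)
qed

lemma coth_minus: "coth (- w) = - coth w"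
  by (simp add: coth_def)

text \<open>Links the ordered pairs in \<open>D2\<close> with the pairs i < j in
  \<open>DBC\<close>.\<close>

lemma sum_offdiagonal:
  fixes h :: "nat \<Rightarrow> nat \<Rightarrow> complex"
  shows "(\<Sum>i<n. \<Sum>j\<in>{..<n} - {i}. h i j) = (\<Sum>i<n. \<Sum>j\<in>{i<..<n}. h i j + h j i)"
proof -
  have split: "(\<Sum>j\<in>{..<n} - {i}. h i j) = (\<Sum>j\<in>{i<..<n}. h i j) + (\<Sum>j<i. h i j)" if "i < n" for i
  proof -
    have "{..<n} - {i} = {i<..<n} \<union> {..<i}" using that by auto
    thus ?thesis by (simp add: sum.union_disjoint disjoint_iff)
  qed
  have "(\<Sum>i<n. \<Sum>j<i. h i j) = (\<Sum>i<n. \<Sum>j<n. if j < i then h i j else 0)"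
    by (intro sum.cong refl sum.mono_neutral_cong_left) auto
  also have "\<dots> = (\<Sum>j<n. \<Sum>i<n. if j < i then h i j else 0)"
    by (rule sum.swap)
  also have "\<dots> = (\<Sum>j<n. \<Sum>i\<in>{j<..<n}. h i j)"
    by (intro sum.cong refl sum.mono_neutral_cong_right) auto
  finally show ?thesis using split by (simp add: sum.distrib)
qed

section \<open>The operator \<open>DBC\<close> in the scaled coordinates\<close>

lemma partial_deriv_scaled_coord:
  assumes "poly_in i f"
  shows "partial_deriv i (\<lambda>z. f (scaled_coord \<delta> z)) =
      (\<lambda>z. 2 * \<delta> * sinh (z i) * partial_deriv i f (scaled_coord \<delta> z))"
    and "partial_deriv i (partial_deriv i (\<lambda>z. f (scaled_coord \<delta> z))) z =
      2 * \<delta> * cosh (z i) * partial_deriv i f (scaled_coord \<delta> z) +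
      (2 * \<delta> * sinh (z i))\<^sup>2 * partial_deriv i (partial_deriv i f) (scaled_coord \<delta> z)"
proof -
  have upd: "scaled_coord \<delta> (z(i := s)) = (scaled_coord \<delta> z)(i := 2 * \<delta> * (cosh s - 1))" for z s
    by (auto simp: scaled_coord_def fun_eq_iff)
  have chain: "((\<lambda>s. g (scaled_coord \<delta> (z(i := s)))) has_field_derivative
      partial_deriv i g (scaled_coord \<delta> z) * (2 * \<delta> * sinh (z i))) (at (z i))"
    if g: "poly_in i g" for g z
  proof -
    have "((\<lambda>t. g ((scaled_coord \<delta> z)(i := t))) has_field_derivative partial_deriv i g (scaled_coord \<delta> z))
        (at (2 * \<delta> * (cosh (z i) - 1)))"
      using has_partial_deriv'[OF g, of "scaled_coord \<delta> z"] by (simp add: scaled_coord_def)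
    moreover have "((\<lambda>s. 2 * \<delta> * (cosh s - 1)) has_field_derivative 2 * \<delta> * sinh (z i)) (at (z i))"
      by (auto intro!: derivative_eq_intros)
    ultimately show ?thesis unfolding upd by (rule DERIV_chain2)
  qed
  show first: "partial_deriv i (\<lambda>z. f (scaled_coord \<delta> z)) =
      (\<lambda>z. 2 * \<delta> * sinh (z i) * partial_deriv i f (scaled_coord \<delta> z))"
    by (intro ext partial_derivI) (use chain[OF assms] in \<open>simp add: mult.commute\<close>)
  have "((\<lambda>s. 2 * \<delta> * sinh s * partial_deriv i f (scaled_coord \<delta> (z(i := s)))) has_field_derivative
      2 * \<delta> * cosh (z i) * partial_deriv i f (scaled_coord \<delta> (z(i := z i))) +
      partial_deriv i (partial_deriv i f) (scaled_coord \<delta> z) * (2 * \<delta> * sinh (z i)) *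
        (2 * \<delta> * sinh (z i))) (at (z i))"
    by (rule DERIV_mult[OF _ chain[OF poly_in_partial_deriv[OF assms]]])
      (auto intro!: derivative_eq_intros)
  thus "partial_deriv i (partial_deriv i (\<lambda>z. f (scaled_coord \<delta> z))) z =
      2 * \<delta> * cosh (z i) * partial_deriv i f (scaled_coord \<delta> z) +
      (2 * \<delta> * sinh (z i))\<^sup>2 * partial_deriv i (partial_deriv i f) (scaled_coord \<delta> z)"
    unfolding first by (intro partial_derivI) (simp add: power2_eq_square mult_ac)
qed

text \<open>The two parameter identities match the first-order terms: one gives the coefficient of
  x_i, the other the constant. The remaining terms come from sinh^2 = cosh^2 - 1 and from
  \<open>coth_half_add\<close>.\<close>

lemma DBC_scaled_coord:
  assumes f: "\<And>i. poly_in i f" and z: "z \<in> regular_points_BC n"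
    and k: "k1 + 2 * k2 + 1 = a" "d * (2 + 4 * k1 + 4 * k2) = 2 + (3 * a - 1) * d" and d: "d \<noteq> 0"
  shows "DBC n k1 k2 \<kappa> (\<lambda>z. f (scaled_coord (of_real d) z)) z =
    deformed_op n a \<kappa> (of_real d) f (scaled_coord (of_real d) z)"
proof -
  define \<delta> where "\<delta> = complex_of_real d"
  define X where "X = scaled_coord \<delta> z"
  define G H where "G i = partial_deriv i f X" and "H i = partial_deriv i (partial_deriv i f) X" for i
  define g where "g i = 2 * \<delta> * sinh (z i) * G i" for i
  have \<delta>: "\<delta> \<noteq> 0" using d by (simp add: \<delta>_def)
  have "complex_of_real (k1 + 2 * k2 + 1) = of_real a"
    "complex_of_real (d * (2 + 4 * k1 + 4 * k2)) = of_real (2 + (3 * a - 1) * d)"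
    by (simp_all only: k)
  hence k': "of_real a = complex_of_real k1 + 2 * of_real k2 + 1"
    "2 + (3 * of_real a - 1) * \<delta> = \<delta> * (2 + 4 * of_real k1 + 4 * of_real k2)"
    by (simp_all add: \<delta>_def)
  have X: "X i = 2 * \<delta> * (cosh (z i) - 1)" for i by (simp add: X_def scaled_coord_def)
  \<comment> \<open>The source of both second-order coefficients: X_i^2 for \<open>D2\<close> and 4
    \<delta> X_i for \<open>lower_op\<close>.\<close>
  have sq: "(2 * \<delta> * sinh (z i))\<^sup>2 = (X i)\<^sup>2 + 4 * \<delta> * X i" for i
    unfolding X power_mult_distrib sinh_square_eq by (simp add: power2_eq_square algebra_simps)
  have first: "2 * \<delta> * cosh (z i) + (of_real k1 * coth (z i / 2) + 2 * of_real k2 * coth (z i)) *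
      (2 * \<delta> * sinh (z i)) = of_real a * X i + (2 + (3 * of_real a - 1) * \<delta>)" if "i < n" for i
  proof -
    have ne: "sinh (z i / 2) \<noteq> 0" "sinh (z i) \<noteq> 0" using z that by (auto simp: regular_points_BC_def)
    have "coth (z i) * sinh (z i) = cosh (z i)" using ne by (simp add: coth_def)
    hence "2 * \<delta> * cosh (z i) + (of_real k1 * coth (z i / 2) + 2 * of_real k2 * coth (z i)) *
        (2 * \<delta> * sinh (z i)) =
        2 * \<delta> * cosh (z i) + 2 * \<delta> * (of_real k1 * (cosh (z i) + 1) + 2 * of_real k2 * cosh (z i))"
      unfolding coth_half_mult_sinh[OF ne(1), symmetric] by (simp add: algebra_simps)
    also have "\<dots> = of_real a * X i + (2 + (3 * of_real a - 1) * \<delta>)"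
      unfolding k'(2) unfolding k'(1) X by (simp add: algebra_simps)
    finally show ?thesis .
  qed
  have pair: "(coth ((z i - z j) / 2) + coth ((z i + z j) / 2)) * g i =
      2 * ((X i)\<^sup>2 / (X i - X j)) * G i + 8 * \<delta> * (X i / (X i - X j)) * G i"
    if "i < n" "j < n" "i \<noteq> j" for i j
  proof -
    have ne: "sinh ((z i - z j) / 2) \<noteq> 0" "sinh ((z i + z j) / 2) \<noteq> 0"
      using z that by (auto simp: regular_points_BC_def)
    have diff: "X i - X j = 2 * \<delta> * (cosh (z i) - cosh (z j))" by (simp add: X algebra_simps)
    have "(coth ((z i - z j) / 2) + coth ((z i + z j) / 2)) * g i =
        2 * (2 * \<delta> * sinh (z i))\<^sup>2 / (X i - X j) * G i"
      using coth_half_add(2)[OF ne] \<delta>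
      by (simp add: coth_half_add(1)[OF ne] diff g_def power_mult_distrib power2_eq_square
          divide_simps del: right_diff_distrib_numeral)
    also have "\<dots> = 2 * ((X i)\<^sup>2 / (X i - X j)) * G i + 8 * \<delta> * (X i / (X i - X j)) * G i"
      unfolding sq by (simp add: add_divide_distrib algebra_simps)
    finally show ?thesis .
  qed
  have pairs: "(\<Sum>i<n. \<Sum>j\<in>{i<..<n}.
      coth ((z i - z j) / 2) * (g i - g j) + coth ((z i + z j) / 2) * (g i + g j)) =
    (\<Sum>i<n. (2 * (\<Sum>j\<in>{..<n} - {i}. (X i)\<^sup>2 / (X i - X j)) +
        8 * \<delta> * (\<Sum>j\<in>{..<n} - {i}. X i / (X i - X j))) * G i)"
  proof -
    \<comment> \<open>Because coth is odd, the difference term takes the same form at both members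
      of a pair, so each pair splits into two ordered summands.\<close>
    have swap: "coth ((z j - z i) / 2) = - coth ((z i - z j) / 2)" for i j
      using coth_minus[of "(z i - z j) / 2"] by (simp add: minus_divide_left)
    have "(\<Sum>i<n. \<Sum>j\<in>{i<..<n}.
        coth ((z i - z j) / 2) * (g i - g j) + coth ((z i + z j) / 2) * (g i + g j)) =
      (\<Sum>i<n. \<Sum>j\<in>{..<n} - {i}. (coth ((z i - z j) / 2) + coth ((z i + z j) / 2)) * g i)"
      unfolding sum_offdiagonal
    proof (intro sum.cong refl)
      fix i j
      show "coth ((z i - z j) / 2) * (g i - g j) + coth ((z i + z j) / 2) * (g i + g j) =
        (coth ((z i - z j) / 2) + coth ((z i + z j) / 2)) * g i +
        (coth ((z j - z i) / 2) + coth ((z j + z i) / 2)) * g j"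
        unfolding swap[of j i] add.commute[of "z j" "z i"] by (simp add: algebra_simps)
    qed
    also have "\<dots> = (\<Sum>i<n. \<Sum>j\<in>{..<n} - {i}.
        2 * ((X i)\<^sup>2 / (X i - X j)) * G i + 8 * \<delta> * (X i / (X i - X j)) * G i)"
      by (intro sum.cong refl pair) auto
    also have "\<dots> = (\<Sum>i<n. (2 * (\<Sum>j\<in>{..<n} - {i}. (X i)\<^sup>2 / (X i - X j)) +
        8 * \<delta> * (\<Sum>j\<in>{..<n} - {i}. X i / (X i - X j))) * G i)"
      by (simp only: sum.distrib sum_distrib_left sum_distrib_right distrib_right)
    finally show ?thesis .
  qed
  have "DBC n k1 k2 \<kappa> (\<lambda>z. f (scaled_coord \<delta> z)) z =
      (\<Sum>i<n. 2 * \<delta> * cosh (z i) * G i + (2 * \<delta> * sinh (z i))\<^sup>2 * H i) +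
      (\<Sum>i<n. (of_real k1 * coth (z i / 2) + 2 * of_real k2 * coth (z i)) * g i) +
      of_real \<kappa> * (\<Sum>i<n. (2 * (\<Sum>j\<in>{..<n} - {i}. (X i)\<^sup>2 / (X i - X j)) +
        8 * \<delta> * (\<Sum>j\<in>{..<n} - {i}. X i / (X i - X j))) * G i)"
    unfolding pairs[symmetric] DBC_def partial_deriv_scaled_coord(2)[OF f]
    unfolding partial_deriv_scaled_coord(1)[OF f]
    unfolding X_def[symmetric] G_def[symmetric] H_def[symmetric] g_def[symmetric] ..
  also have "\<dots> = (\<Sum>i<n. (2 * \<delta> * sinh (z i))\<^sup>2 * H i +
      (2 * \<delta> * cosh (z i) + (of_real k1 * coth (z i / 2) + 2 * of_real k2 * coth (z i)) *
        (2 * \<delta> * sinh (z i)) +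
      of_real \<kappa> * (2 * (\<Sum>j\<in>{..<n} - {i}. (X i)\<^sup>2 / (X i - X j)) +
        8 * \<delta> * (\<Sum>j\<in>{..<n} - {i}. X i / (X i - X j)))) * G i)"
    unfolding sum_distrib_left[of "complex_of_real \<kappa>"] sum.distrib[symmetric] g_def
    by (intro sum.cong refl) (simp only: distrib_right mult.assoc add_ac)
  also have "\<dots> = (\<Sum>i<n. ((X i)\<^sup>2 + 4 * \<delta> * X i) * H i +
      (of_real a * X i + (2 + (3 * of_real a - 1) * \<delta>) +
      of_real \<kappa> * (2 * (\<Sum>j\<in>{..<n} - {i}. (X i)\<^sup>2 / (X i - X j)) +
        8 * \<delta> * (\<Sum>j\<in>{..<n} - {i}. X i / (X i - X j)))) * G i)"
    by (intro sum.cong refl) (simp only: sq first lessThan_iff)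
  also have "\<dots> = deformed_op n a \<kappa> \<delta> f X"
    unfolding deformed_op_def D2_diff_op euler_op_diff_op lower_op_def diff_op_def D2_coeff1_def
      G_def[symmetric] H_def[symmetric] sum_distrib_left[of "complex_of_real a"] sum.distrib[symmetric]
    by (intro sum.cong refl) (simp add: algebra_simps)
  finally show ?thesis by (simp add: X_def \<delta>_def)
qed

text \<open>Complex \<open>cosh\<close> is onto, via cosh (i w) = cos w and \<open>Arccos\<close>.
  The excluded coordinates 0 and -4 \<delta> are those with cosh equal to 1 and -1, and distinct
  coordinates have distinct cosh.\<close>

lemma scaled_coord_surj:
  assumes \<delta>: "\<delta> \<noteq> 0" and x: "x \<in> generic_points n" "\<forall>i<n. x i \<noteq> - 4 * \<delta>"
  obtains z where "z \<in> regular_points_BC n" "scaled_coord \<delta> z = x"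
proof
  define z where "z i = \<i> * Arccos (1 + x i / (2 * \<delta>))" for i
  have cosh: "cosh (z i) = 1 + x i / (2 * \<delta>)" for i
    by (simp add: z_def cosh_conv_cos flip: mult.assoc)
  show X: "scaled_coord \<delta> z = x"
    using \<delta> by (simp add: scaled_coord_def cosh fun_eq_iff)
  have half: "sinh (z i / 2) \<noteq> 0" if "i < n" for i
    using cosh[of i] cosh_eq_sinh_half[of "z i"] x(1) that \<delta>
    by (auto simp: generic_points_def)
  have full: "sinh (z i) \<noteq> 0" if "i < n" for i
  proof
    assume "sinh (z i) = 0"
    hence "(cosh (z i))\<^sup>2 = 1" using cosh_square_eq[of "z i"] by simp
    hence "cosh (z i) = 1 \<or> cosh (z i) = - 1" by (simp add: power2_eq_1_iff)
    hence "x i = 0 \<or> x i = - 4 * \<delta>"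
    proof
      assume "cosh (z i) = 1"
      thus ?thesis using \<delta> by (simp add: cosh)
    next
      assume "cosh (z i) = - 1"
      hence "x i / (2 * \<delta>) = - 2" unfolding cosh by (simp add: eq_neg_iff_add_eq_0 add.commute)
      thus ?thesis using \<delta> by (simp add: divide_eq_eq)
    qed
    thus False using x that by (auto simp: generic_points_def)
  qed
  have diff: "sinh ((z i - z j) / 2) \<noteq> 0 \<and> sinh ((z i + z j) / 2) \<noteq> 0"
    if "i < n" "j < n" "i \<noteq> j" for i j
  proof -
    have "cosh (z i) \<noteq> cosh (z j)"
      using x(1) that \<delta> by (simp add: cosh generic_points_def regular_points_def)
    moreover have "cosh (z i) - cosh (z j) = 2 * sinh ((z i - z j) / 2) * sinh ((z i + z j) / 2)"
    proof -
      have "z i = (z i + z j) / 2 + (z i - z j) / 2" "z j = (z i + z j) / 2 - (z i - z j) / 2"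
        by (simp_all add: field_simps)
      from arg_cong[OF this(1), of cosh] arg_cong[OF this(2), of cosh] show ?thesis
        unfolding cosh_add[of "(z i + z j) / 2"] cosh_diff[of "(z i + z j) / 2"] by simp
    qed
    ultimately show ?thesis by auto
  qed
  show "z \<in> regular_points_BC n"
    using half full diff by (auto simp: regular_points_BC_def)
qed

section \<open>The limit of the shifted coordinates\<close>

lemma of_real_exp_minus_tendsto: "((\<lambda>\<epsilon>. complex_of_real (exp (- \<epsilon>))) \<longlongrightarrow> 0) at_top"
proof -
  have "((\<lambda>\<epsilon>. complex_of_real (exp (- \<epsilon>))) \<longlongrightarrow> of_real 0) at_top"
    by (intro tendsto_of_real filterlim_compose[OF exp_at_bot] filterlim_uminus_at_bot_at_top)
  thus ?thesis by simp
qed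

lemma scaled_coord_shift_tendsto:
  "((\<lambda>\<epsilon>. scaled_coord (of_real (exp (- \<epsilon>))) (\<lambda>i. z i + of_real \<epsilon>) i) \<longlongrightarrow> exp (z i)) at_top"
proof -
  \<comment> \<open>In exponentials the factor e^\<epsilon> of the growing term cancels against
    \<delta>, and the other terms carry powers of e^(-\<epsilon>).\<close>
  have eq: "scaled_coord (of_real (exp (- \<epsilon>))) (\<lambda>i. z i + of_real \<epsilon>) i =
      exp (z i) + of_real (exp (- \<epsilon>)) * of_real (exp (- \<epsilon>)) * exp (- z i) -
      2 * of_real (exp (- \<epsilon>))" for \<epsilon> :: real
  proof -
    define E where "E = complex_of_real (exp \<epsilon>)"
    have E: "E \<noteq> 0" "complex_of_real (exp (- \<epsilon>)) = 1 / E" "exp (z i + of_real \<epsilon>) = exp (z i) * E"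
      "exp (- (z i + of_real \<epsilon>)) = exp (- z i) / E"
      by (simp_all add: E_def exp_minus inverse_eq_divide exp_add exp_of_real exp_diff
          minus_add_distrib[symmetric] del: minus_add_distrib)
    show ?thesis unfolding scaled_coord_def cosh_field_def E(2-4)
      using E(1) by (simp add: field_simps)
  qed
  have "((\<lambda>\<epsilon>. exp (z i) + of_real (exp (- \<epsilon>)) * of_real (exp (- \<epsilon>)) * exp (- z i) -
      2 * of_real (exp (- \<epsilon>))) \<longlongrightarrow> exp (z i) + 0 * 0 * exp (- z i) - 2 * 0) at_top"
    by (intro tendsto_diff tendsto_add tendsto_mult tendsto_const of_real_exp_minus_tendsto)
  thus ?thesis unfolding eq by simp
qed

section \<open>Coefficients of the Jacobi and Bessel polynomials\<close>

context jack_family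
begin

text \<open>By homogeneity, passing from \<open>t_coord\<close> to \<open>scaled_coord\<close> costs
  (-1 / (4 \<delta>))^|mu|. For \<open>lam\<close> this cancels against (-4)^|lam| and the prefactor
  \<delta>^|lam|, so the leading coefficient is 1.\<close>

lemma jacobi_BC_rescaled:
  assumes Q: "is_jacobi_BC n k1 k2 \<kappa> lam Q" and d: "d \<noteq> 0"
    and k: "k1 + 2 * k2 + 1 = a" "d * (2 + 4 * k1 + 4 * k2) = 2 + (3 * a - 1) * d"
  shows "\<exists>v. solves_recursion a (of_real d) v \<and> (\<forall>z. of_real d ^ weight n lam * Q z =
    (\<Sum>mu\<in>contained n lam. v mu * P mu (scaled_coord (of_real d) z)))"
proof -
  define \<delta> where "\<delta> = complex_of_real d"
  have \<delta>: "\<delta> \<noteq> 0" using d by (simp add: \<delta>_def)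
  obtain u c where u: "Q = (\<lambda>z. (-4) ^ weight n lam * P lam (t_coord z) +
        (\<Sum>mu\<in>{mu \<in> partitions n. mu < lam}. u mu * P mu (t_coord z)))"
    and c: "\<And>z. z \<in> regular_points_BC n \<Longrightarrow> DBC n k1 k2 \<kappa> Q z = c * Q z"
    using Q by (auto simp: is_jacobi_BC_def eigenfunction_on_def)
  define w where "w mu = (if mu = lam then (-4) ^ weight n lam else u mu) *
    (- 1 / (4 * \<delta>)) ^ weight n mu" for mu
  define v where "v mu = \<delta> ^ weight n lam * w mu" for mu
  have "\<delta> * (- 4 * (- 1 / (4 * \<delta>))) = 1" using \<delta> by simp
  hence "(\<delta> * (- 4 * (- 1 / (4 * \<delta>)))) ^ weight n lam = 1" by (simp only: power_one)
  hence v_lam: "v lam = 1" by (simp only: v_def w_def power_mult_distrib if_True refl)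
  have proper: "{mu \<in> partitions n. mu < lam} = contained n lam - {lam}"
    by (auto simp: contained_def)
  have t: "P mu (t_coord z) = (- 1 / (4 * \<delta>)) ^ weight n mu * P mu (scaled_coord \<delta> z)"
    if "mu \<in> contained n lam" for mu z
  proof -
    have "t_coord z = (\<lambda>i. - 1 / (4 * \<delta>) * scaled_coord \<delta> z i)"
      using \<delta> by (simp add: scaled_coord_t_coord fun_eq_iff)
    thus ?thesis by (simp only: mspan_homogeneous[OF jack_mspan[OF that]])
  qed
  have Q_eq: "Q z = (\<Sum>mu\<in>contained n lam. w mu * P mu (scaled_coord \<delta> z))" for z
    unfolding u proper sum.remove[OF finite_contained[OF lam] lam_contained]
    by (intro arg_cong2[of _ _ _ _ "(+)"] sum.cong) (auto simp: t w_def lam_contained)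
  have expand: "of_real d ^ weight n lam * Q z =
      (\<Sum>mu\<in>contained n lam. v mu * P mu (scaled_coord (of_real d) z))" for z
    by (simp add: Q_eq v_def sum_distrib_left mult.assoc flip: \<delta>_def)
  have poly: "poly_in i (P mu)" if "mu \<in> contained n lam" for i mu
    by (rule mspan_poly_in[OF jack_mspan[OF that]])
  have eig: "(\<Sum>mu\<in>contained n lam. w mu * deformed_op n a \<kappa> \<delta> (P mu) x) =
      c * (\<Sum>mu\<in>contained n lam. w mu * P mu x)"
    if x: "x \<in> generic_points n" "\<forall>i<n. x i \<noteq> - 4 * \<delta>" for x
  proof -
    obtain z where z: "z \<in> regular_points_BC n" "scaled_coord \<delta> z = x"
      using scaled_coord_surj[OF \<delta> x] .
    have "c * Q z = DBC n k1 k2 \<kappa> (\<lambda>z. \<Sum>mu\<in>contained n lam. w mu * P mu (scaled_coord \<delta> z)) z"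
      unfolding c[OF z(1), symmetric]
      by (rule arg_cong[where f = "\<lambda>q. DBC n k1 k2 \<kappa> q z"]) (intro ext Q_eq)
    also have "\<dots> = deformed_op n a \<kappa> \<delta> (\<lambda>x. \<Sum>mu\<in>contained n lam. w mu * P mu x) (scaled_coord \<delta> z)"
      unfolding \<delta>_def by (rule DBC_scaled_coord[OF poly_in_sum[OF poly] z(1) k d])
    finally show ?thesis
      by (simp add: Q_eq z(2) deformed_op_sum[OF finite_contained[OF lam] poly])
  qed
  have eig_v: "(\<Sum>mu\<in>contained n lam. v mu * deformed_op n a \<kappa> \<delta> (P mu) x) =
      c * (\<Sum>mu\<in>contained n lam. v mu * P mu x)"
    if "x \<in> generic_points n" "\<forall>i<n. x i \<noteq> - 4 * \<delta>" for x
    using arg_cong[OF eig[OF that], of "\<lambda>t. \<delta> ^ weight n lam * t"]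
    by (simp add: v_def sum_distrib_left mult_ac)
  have "solves_recursion a (of_real d) v"
    unfolding \<delta>_def[symmetric] by (rule eigenfunction_solves_recursion[OF eig_v v_lam])
  with expand show ?thesis by blast
qed

lemma bessel_coeffs:
  assumes Y: "is_bessel n a \<kappa> lam Y"
  shows "\<exists>u. solves_recursion a 0 u \<and> Y = (\<lambda>x. \<Sum>mu\<in>contained n lam. u mu * P mu x)"
proof -
  obtain u' c where u': "Y = (\<lambda>x. P lam x + (\<Sum>mu\<in>{mu \<in> partitions n. mu < lam}. u' mu * P mu x))"
    and c: "\<And>x. x \<in> regular_points n \<Longrightarrow> DB n a \<kappa> Y x = c * Y x"
    using Y by (auto simp: is_bessel_def eigenfunction_on_def)
  define u where "u = u'(lam := 1)"
  have u_lam: "u lam = 1" by (simp add: u_def)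
  have proper: "{mu \<in> partitions n. mu < lam} = contained n lam - {lam}"
    by (auto simp: contained_def)
  have Y_eq: "Y = (\<lambda>x. \<Sum>mu\<in>contained n lam. u mu * P mu x)"
    unfolding u' proper sum.remove[OF finite_contained[OF lam] lam_contained]
    by (intro ext arg_cong2[of _ _ _ _ "(+)"] sum.cong) (auto simp: u_def)
  have poly: "poly_in i (P mu)" if "mu \<in> contained n lam" for i mu
    by (rule mspan_poly_in[OF jack_mspan[OF that]])
  have eig: "(\<Sum>mu\<in>contained n lam. u mu * deformed_op n a \<kappa> 0 (P mu) x) =
      c * (\<Sum>mu\<in>contained n lam. u mu * P mu x)" if "x \<in> generic_points n" for x
    using c[of x] that
    by (simp add: Y_eq DB_eq_deformed_op deformed_op_sum[OF finite_contained[OF lam] poly]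
        generic_points_def)
  have "solves_recursion a 0 u"
    by (rule eigenfunction_solves_recursion[OF eig]) (simp_all add: u_lam)
  with Y_eq show ?thesis by blast
qed

end

theorem proposition4p1:
  fixes n :: nat and a \<kappa> :: real and lam :: "nat \<Rightarrow> nat"
    and Y :: "(nat \<Rightarrow> complex) \<Rightarrow> complex"
    and PBC :: "real \<Rightarrow> (nat \<Rightarrow> complex) \<Rightarrow> complex"
    and z :: "nat \<Rightarrow> complex"
  assumes "n \<ge> 1"
    and "lam \<in> partitions n"
    and "bessel_well_defined n a \<kappa> lam"
    and "is_bessel n a \<kappa> lam Y"
    and "\<And>\<epsilon>. is_jacobi_BC n ((a - 1 + 2 * exp \<epsilon>) / 2) ((a - 1 - 2 * exp \<epsilon>) / 4) \<kappa> lam (PBC \<epsilon>)"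
  shows "((\<lambda>\<epsilon>. of_real (exp (- \<epsilon> * real (weight n lam))) * PBC \<epsilon> (\<lambda>i. z i + of_real \<epsilon>))
           \<longlongrightarrow> Y (\<lambda>i. exp (z i))) at_top"
proof -
  interpret jack_family n \<kappa> lam
  proof
    show "is_jack n \<kappa> mu (jack n \<kappa> mu)" if "mu \<in> contained n lam" for mu
    proof -
      have "\<exists>!p. is_jack n \<kappa> mu p"
        using assms(3) that by (simp add: bessel_well_defined_def contained_def)
      thus ?thesis unfolding jack_def by (rule theI')
    qed
  qed (rule assms(2))
  obtain u where u: "solves_recursion a 0 u" "Y = (\<lambda>x. \<Sum>mu\<in>contained n lam. u mu * P mu x)"
    using bessel_coeffs[OF assms(4)] by blast
  have "\<exists>v. solves_recursion a (of_real (exp (- \<epsilon>))) v \<and>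
      (\<forall>z. of_real (exp (- \<epsilon>)) ^ weight n lam * PBC \<epsilon> z =
        (\<Sum>mu\<in>contained n lam. v mu * P mu (scaled_coord (of_real (exp (- \<epsilon>))) z)))" for \<epsilon>
    \<comment> \<open>Here d = e^(-\<epsilon>): in k1 + 2 k2 the terms e^\<epsilon> cancel, and 4 k1
      + 4 k2 = 3 (a - 1) + 2 e^\<epsilon>.\<close>
    by (rule jacobi_BC_rescaled[OF assms(5)[of \<epsilon>]]) (simp_all add: exp_minus field_simps)
  then obtain v where v: "\<And>\<epsilon>. solves_recursion a (of_real (exp (- \<epsilon>))) (v \<epsilon>)"
    "\<And>\<epsilon> z. of_real (exp (- \<epsilon>)) ^ weight n lam * PBC \<epsilon> z =
        (\<Sum>mu\<in>contained n lam. v \<epsilon> mu * P mu (scaled_coord (of_real (exp (- \<epsilon>))) z))"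
    by metis
  have coeffs: "((\<lambda>\<epsilon>. v \<epsilon> mu) \<longlongrightarrow> u mu) at_top" if "mu \<in> contained n lam" for mu
    by (rule eigenfunction_coeffs_tendsto[OF of_real_exp_minus_tendsto _ v(1) u(1) that])
      (use assms(3) in \<open>simp add: bessel_well_defined_def\<close>)
  have "of_real (exp (- \<epsilon> * real (weight n lam))) = complex_of_real (exp (- \<epsilon>)) ^ weight n lam" for \<epsilon>
    using exp_of_nat_mult[of "weight n lam" "- \<epsilon>"] by (simp add: mult.commute flip: of_real_power)
  \<comment> \<open>Coefficients and evaluation points converge simultaneously, and Jack polynomials
    are continuous.\<close>
  moreover have "((\<lambda>\<epsilon>. \<Sum>mu\<in>contained n lam.
      v \<epsilon> mu * P mu (scaled_coord (of_real (exp (- \<epsilon>))) (\<lambda>i. z i + of_real \<epsilon>))) \<longlongrightarrow>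
      (\<Sum>mu\<in>contained n lam. u mu * P mu (\<lambda>i. exp (z i)))) at_top"
    by (intro tendsto_sum tendsto_mult coeffs mspan_tendsto[OF jack_mspan] scaled_coord_shift_tendsto)
  ultimately show ?thesis by (simp only: v(2) u(2))
qed

end
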